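(* Let $B$ be the commutative ring \[ B = \frac{R\left[b_{i,j} \mid i \in [1,r],\ j \in \mathbb{Z} \right]}{\left(b_{i,j}^2 - \sigma^{-j}((z - \alpha_i)^{n_i}) \mid i \in [1,r],\ j \in \mathbb{Z} \right)} \] associated with $(R,\sigma,f)$ as described in the context. (1) If $n_i$ is odd for all $i \in [1, r]$, then $B$ is a domain. (2) The ring $B$ is coherent.
   Context: $\Bbbk$ is an algebraically closed field of characteristic zero. Either (1) $R=\Bbbk[z]$ and $\sigma$ is the automorphism $\sigma(z)=z+1$, or (2) $R=\Bbbk[z,z^{-1}]$ and $\sigma(z)=\xi z$ with $\xi\in\Bbbk^\times$ not a root of unity. $f\in\Bbbk[z]$ is monic with $f(0)\ne0$ in the second case. Put $\sigma_\Bbbk(\lambda)=\lambda-1$ in the first case, $\sigma_\Bbbk(\lambda)=\xi^{-1}\lambda$ in the second; no two distinct roots of $f$ lie on the same $\sigma_\Bbbk$-orbit. $\alpha_1,\dots,\alpha_r$ are the distinct roots of $f$, with multiplicities $n_1,\dots,n_r$. $[1,r]=\{1,\dots,r\}$. A commutative ring is coherent if every finitely generated ideal is finitely presented. *)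

theory Defs
  imports
    "HOL-Algebra.QuotRing"
    "HOL-Algebra.Module"
    "HOL-Algebra.Algebraic_Closure_Type"
    "HOL-Library.Poly_Mapping"
begin

text \<open>\<open>inv_into UNIV g\<close> is the inverse of \<open>g\<close>; only used for bijective \<open>g\<close>.\<close>

definition int_iterate :: "('a \<Rightarrow> 'a) \<Rightarrow> int \<Rightarrow> 'a \<Rightarrow> 'a" where
  "int_iterate g j = (if 0 \<le> j then g ^^ nat j else inv_into UNIV g ^^ nat (- j))"

definition same_orbit :: "('a \<Rightarrow> 'a) \<Rightarrow> 'a \<Rightarrow> 'a \<Rightarrow> bool" where
  "same_orbit g x y \<longleftrightarrow> (\<exists>j. y = int_iterate g j x)"

text \<open>
  The automorphisms of the two base rings: \<open>z\<close> is sent to \<open>z + 1\<close> in \<open>'k poly\<close>, and to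
  \<open>\<xi> z\<close> in \<open>'k laurent_poly\<close> (there, the coefficient of \<open>z\<close> to the \<open>k\<close> is multiplied by
  \<open>\<xi>\<close> to the \<open>k\<close>).
\<close>

definition poly_translate :: "'k::comm_ring_1 poly \<Rightarrow> 'k poly" where
  "poly_translate p = p \<circ>\<^sub>p [:1, 1:]"

text \<open>
  Laurent polynomials are finitely supported functions on the integers with convolution as
  multiplication, i.e. the group algebra of the integers.
\<close>

type_synonym 'k laurent_poly = "int \<Rightarrow>\<^sub>0 'k"

definition laurent_const :: "'k \<Rightarrow> 'k::zero laurent_poly" where
  "laurent_const c = Poly_Mapping.single 0 c"

definition laurent_X :: "'k::zero_neq_one laurent_poly" where
  "laurent_X = Poly_Mapping.single 1 1"

definition laurent_dilate :: "'k::field \<Rightarrow> 'k laurent_poly \<Rightarrow> 'k laurent_poly" where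
  "laurent_dilate \<xi> = Poly_Mapping.mapp (\<lambda>k c. \<xi> powi k * c)"

text \<open>
  A monomial is a finitely supported exponent function. The type \<open>'i\<close> may have more elements
  than there are variables, so the carrier is restricted to the polynomials whose variables
  lie in \<open>I\<close>.
\<close>

definition mpoly_ring :: "'i set \<Rightarrow> (('i \<Rightarrow>\<^sub>0 nat) \<Rightarrow>\<^sub>0 'r::comm_ring_1) ring" where
  "mpoly_ring I = ring_of_type_algebra
     \<lparr>carrier := {p. \<forall>m \<in> Poly_Mapping.keys p. Poly_Mapping.keys m \<subseteq> I}\<rparr>"

definition mpoly_var :: "'i \<Rightarrow> (('i \<Rightarrow>\<^sub>0 nat) \<Rightarrow>\<^sub>0 'r::comm_ring_1)" where
  "mpoly_var i = Poly_Mapping.single (Poly_Mapping.single i 1) 1"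

definition mpoly_const :: "'r \<Rightarrow> (('i \<Rightarrow>\<^sub>0 nat) \<Rightarrow>\<^sub>0 'r::comm_ring_1)" where
  "mpoly_const c = Poly_Mapping.single 0 c"

text \<open>
  \<open>h i\<close> stands for the power of \<open>z - \<alpha>\<^sub>i\<close> with exponent the multiplicity of \<open>\<alpha>\<^sub>i\<close>. The variable
  \<open>b\<close> with subscripts \<open>i\<close>, \<open>j\<close> has index \<open>(i, j)\<close>.
\<close>

definition B_relations ::
    "('r \<Rightarrow> 'r) \<Rightarrow> (nat \<Rightarrow> 'r) \<Rightarrow> nat \<Rightarrow> ((nat \<times> int \<Rightarrow>\<^sub>0 nat) \<Rightarrow>\<^sub>0 'r::comm_ring_1) set" where
  "B_relations \<sigma> h r =
     {mpoly_var (i, j) ^ 2 - mpoly_const (int_iterate \<sigma> (- j) (h i)) | i j. i \<in> {1..r}}"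

definition B_ring ::
    "('r \<Rightarrow> 'r) \<Rightarrow> (nat \<Rightarrow> 'r) \<Rightarrow> nat \<Rightarrow> ((nat \<times> int \<Rightarrow>\<^sub>0 nat) \<Rightarrow>\<^sub>0 'r::comm_ring_1) set ring" where
  "B_ring \<sigma> h r =
     (let P = mpoly_ring ({1..r} \<times> UNIV) in P Quot (Idl\<^bsub>P\<^esub> (B_relations \<sigma> h r)))"

text \<open>The fields \<open>mult\<close> and \<open>one\<close> of a module record are irrelevant and left unspecified.\<close>

definition free_module :: "('a, 'm) ring_scheme \<Rightarrow> nat \<Rightarrow> ('a, nat \<Rightarrow> 'a) module" where
  "free_module R n =
     \<lparr>carrier = {..<n} \<rightarrow>\<^sub>E carrier R, monoid.mult = undefined, one = undefined,
      zero = (\<lambda>i\<in>{..<n}. \<zero>\<^bsub>R\<^esub>), add = (\<lambda>v w. \<lambda>i\<in>{..<n}. v i \<oplus>\<^bsub>R\<^esub> w i),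
      module.smult = (\<lambda>a v. \<lambda>i\<in>{..<n}. a \<otimes>\<^bsub>R\<^esub> v i)\<rparr>"

definition ideal_module :: "('a, 'm) ring_scheme \<Rightarrow> 'a set \<Rightarrow> ('a, 'a) module" where
  "ideal_module R I =
     \<lparr>carrier = I, monoid.mult = undefined, one = undefined,
      zero = \<zero>\<^bsub>R\<^esub>, add = add R, module.smult = monoid.mult R\<rparr>"

definition module_homs ::
    "('a, 'm) ring_scheme \<Rightarrow> ('a, 'b, 'n) module_scheme \<Rightarrow> ('a, 'c, 'o) module_scheme \<Rightarrow> ('b \<Rightarrow> 'c) set"
  where
  "module_homs R M N =
     {\<phi> \<in> carrier M \<rightarrow> carrier N.
        (\<forall>x \<in> carrier M. \<forall>y \<in> carrier M. \<phi> (x \<oplus>\<^bsub>M\<^esub> y) = \<phi> x \<oplus>\<^bsub>N\<^esub> \<phi> y) \<and>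
        (\<forall>a \<in> carrier R. \<forall>x \<in> carrier M. \<phi> (a \<odot>\<^bsub>M\<^esub> x) = a \<odot>\<^bsub>N\<^esub> \<phi> x)}"

definition fg_submodule :: "'b set \<Rightarrow> ('a, 'm) ring_scheme \<Rightarrow> ('a, 'b, 'n) module_scheme \<Rightarrow> bool" where
  "fg_submodule H R M \<longleftrightarrow>
     (\<exists>S. finite S \<and> S \<subseteq> carrier M \<and> H = \<Inter>{N. submodule N R M \<and> S \<subseteq> N})"

text \<open>A finite presentation: a surjection from a finite free module with finitely generated kernel.\<close>

definition finitely_presented :: "('a, 'm) ring_scheme \<Rightarrow> ('a, 'b, 'n) module_scheme \<Rightarrow> bool" where
  "finitely_presented R M \<longleftrightarrow>
     (\<exists>n. \<exists>\<phi> \<in> module_homs R (free_module R n) M.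
        \<phi> ` carrier (free_module R n) = carrier M \<and>
        fg_submodule {v \<in> carrier (free_module R n). \<phi> v = \<zero>\<^bsub>M\<^esub>} R (free_module R n))"

definition fg_ideal :: "'a set \<Rightarrow> ('a, 'm) ring_scheme \<Rightarrow> bool" where
  "fg_ideal I R \<longleftrightarrow> (\<exists>S. finite S \<and> S \<subseteq> carrier R \<and> I = Idl\<^bsub>R\<^esub> S)"

definition coherent_ring :: "('a, 'm) ring_scheme \<Rightarrow> bool" where
  "coherent_ring R \<longleftrightarrow>
     cring R \<and> (\<forall>I. fg_ideal I R \<longrightarrow> finitely_presented R (ideal_module R I))"

end

theory Submission
  imports Defs "HOL-Library.Function_Algebras"
begin

text \<open>
  Modulo the relations, every monomial reduces to its squarefree part times a scalar: replace
  each even power of a variable by the corresponding power of the radicand. This normal form is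
  linear over the base ring and its kernel is exactly the ideal of relations, so \<open>B\<close> is free over
  the base ring on the squarefree monomials.

  Coherence. Finitely many elements involve a finite set \<open>F\<close> of variables. Grouping a reduced
  syzygy by the part of each monomial outside \<open>F\<close> writes it as a combination of syzygies with
  entries in the span of the squarefree monomials in \<open>F\<close>; these form a submodule of a finite free
  module over the noetherian base ring.

  Domain. Map the base ring to the algebraic closure of \<open>k(z)\<close> and the variables to square
  roots. The orbit hypothesis makes the radicands odd powers of pairwise non-associate linear
  polynomials, so no nonempty subproduct is a square in \<open>k(z)\<close>. Hence (Besicovitch) the
  products of the square roots are linearly independent over \<open>k(z)\<close>, the map is injective on
  normal forms, and the ideal of relations is the kernel of a homomorphism to a field.
\<close>

section \<open>Additive maps on monoid algebras\<close>

text \<open>\<open>B\<close> has infinitely many generators, so the Hilbert basis theorem does not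
  apply to it. Flatness in explicit form takes its place. Let B_F be the subring generated over the
  base ring by the variables in a finite set F. A squarefree monomial splits uniquely into a part
  inside and a part outside F, so \<open>B\<close> is free over B_F on the squarefree monomials
  outside F. A linear equation with coefficients in B_F holds in \<open>B\<close> exactly when it
  holds in each coordinate, and B_F is a finite module over the noetherian base ring. For the domain
  part, what matters about the automorphism is where it moves roots: the radicand with indices i, j
  has its root at the (-j)-th iterate of \<sigma>_k applied to \<alpha>_i. Different i are kept
  apart by the orbit hypothesis. Different j for the same i are kept apart by characteristic zero in
  the first case, and in the second by f(0) being nonzero and \<xi> not being a root of unity. A
  product of distinct radicands then vanishes to odd order at the root of each factor, which a
  square of a rational function cannot do.\<close>

lemma poly_mapping_expansion:
  fixes p :: "'m \<Rightarrow>\<^sub>0 'a::comm_monoid_add"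
  shows "p = (\<Sum>m\<in>Poly_Mapping.keys p. Poly_Mapping.single m (Poly_Mapping.lookup p m))"
proof (rule poly_mapping_eqI)
  fix k
  have "(\<Sum>m\<in>Poly_Mapping.keys p. Poly_Mapping.lookup (Poly_Mapping.single m (Poly_Mapping.lookup p m)) k)
      = (\<Sum>m\<in>Poly_Mapping.keys p. if m = k then Poly_Mapping.lookup p k else 0)"
    by (intro sum.cong) (auto simp: lookup_single)
  also have "\<dots> = Poly_Mapping.lookup p k"
    by (auto simp: not_in_keys_iff_lookup_eq_zero)
  finally show "Poly_Mapping.lookup p k =
      Poly_Mapping.lookup (\<Sum>m\<in>Poly_Mapping.keys p. Poly_Mapping.single m (Poly_Mapping.lookup p m)) k"
    by (simp add: lookup_sum)
qed

text \<open>The base case may use that \<open>m\<close> occurs in \<open>p\<close>, which is how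
  support conditions on \<open>p\<close> enter. The summands in the last case are unconstrained, so
  whatever is needed there has to be part of \<open>Q\<close>.\<close>

lemma poly_mapping_single_add_induct [case_names zero single add]:
  fixes p :: "'m \<Rightarrow>\<^sub>0 'a::comm_monoid_add"
  assumes "Q 0" and "\<And>m c. m \<in> Poly_Mapping.keys p \<Longrightarrow> Q (Poly_Mapping.single m c)"
    and "\<And>p q. Q p \<Longrightarrow> Q q \<Longrightarrow> Q (p + q)"
  shows "Q p"
proof -
  have "Q (\<Sum>m\<in>A. Poly_Mapping.single m (Poly_Mapping.lookup p m))"
    if "finite A" "A \<subseteq> Poly_Mapping.keys p" for A
    using that by (induction A rule: finite_induct) (auto intro: assms)
  from this[OF finite_keys order_refl] show ?thesis
    using poly_mapping_expansion[of p] by simp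
qed

lemma additive_eq_on_singles:
  fixes p :: "'m \<Rightarrow>\<^sub>0 'a::ab_group_add"
  assumes "additive F" "additive G"
    and "\<And>m c. m \<in> Poly_Mapping.keys p \<Longrightarrow> F (Poly_Mapping.single m c) = G (Poly_Mapping.single m c)"
  shows "F p = G p"
  by (induction p rule: poly_mapping_single_add_induct)
    (simp_all add: assms(3) additive.zero[OF assms(1)] additive.zero[OF assms(2)]
      additive.add[OF assms(1)] additive.add[OF assms(2)])

text \<open>Coefficients need only be mapped additively, so one construction covers normal forms,
  slices and changes of coefficient ring.\<close>

definition lin_ext :: "('m \<Rightarrow> 'a \<Rightarrow> 'b) \<Rightarrow> ('m \<Rightarrow>\<^sub>0 'a::ab_group_add) \<Rightarrow> 'b::ab_group_add" where
  "lin_ext f p = (\<Sum>m\<in>Poly_Mapping.keys p. f m (Poly_Mapping.lookup p m))"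

lemma lin_ext_superset:
  assumes "\<And>m. additive (f m)" "finite A" "Poly_Mapping.keys p \<subseteq> A"
  shows "lin_ext f p = (\<Sum>m\<in>A. f m (Poly_Mapping.lookup p m))"
  unfolding lin_ext_def using assms(2,3)
  by (intro sum.mono_neutral_left) (auto simp: additive.zero[OF assms(1)] in_keys_iff)

lemma additive_lin_ext:
  assumes f: "\<And>m. additive (f m)"
  shows "additive (lin_ext f)"
proof
  fix p q :: "'a \<Rightarrow>\<^sub>0 'b"
  let ?A = "Poly_Mapping.keys p \<union> Poly_Mapping.keys q"
  have A: "finite ?A" by simp
  show "lin_ext f (p + q) = lin_ext f p + lin_ext f q"
    using lin_ext_superset[OF f A, of p] lin_ext_superset[OF f A, of q]
      lin_ext_superset[OF f A keys_add]
    by (simp add: lookup_add additive.add[OF f] sum.distrib)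
qed

lemma lin_ext_single:
  assumes "\<And>m. additive (f m)"
  shows "lin_ext f (Poly_Mapping.single m c) = f m c"
  by (simp add: lin_ext_def additive.zero[OF assms])

text \<open>The universal property of a monoid algebra. It serves exponent vectors (polynomials) and
  integer exponents (Laurent polynomials) alike.\<close>

definition monoid_algebra_eval :: "('a \<Rightarrow> 'b) \<Rightarrow> ('m \<Rightarrow> 'b) \<Rightarrow> ('m \<Rightarrow>\<^sub>0 'a::ab_group_add) \<Rightarrow> 'b::comm_ring_1"
  where "monoid_algebra_eval g \<chi> = lin_ext (\<lambda>m c. g c * \<chi> m)"

lemma additive_eval:
  assumes "additive g"
  shows "additive (monoid_algebra_eval g \<chi>)"
  unfolding monoid_algebra_eval_def
  by (intro additive_lin_ext) (simp add: additive_def additive.add[OF assms] distrib_right)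

lemma eval_single:
  assumes "additive g"
  shows "monoid_algebra_eval g \<chi> (Poly_Mapping.single m c) = g c * \<chi> m"
  unfolding monoid_algebra_eval_def
  by (intro lin_ext_single) (simp add: additive_def additive.add[OF assms] distrib_right)

text \<open>Both sides are biadditive, so it suffices to compare them on products of two
  monomials.\<close>

lemma eval_mult:
  fixes g :: "'a::comm_ring_1 \<Rightarrow> 'b::comm_ring_1" and \<chi> :: "'m::comm_monoid_add \<Rightarrow> 'b"
  assumes g: "additive g" "\<And>a b. g (a * b) = g a * g b"
    and \<chi>: "\<And>m n. \<chi> (m + n) = \<chi> m * \<chi> n"
  shows "monoid_algebra_eval g \<chi> (p * q) = monoid_algebra_eval g \<chi> p * monoid_algebra_eval g \<chi> q"
proof -
  let ?e = "monoid_algebra_eval g \<chi>"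
  note add = additive.add[OF additive_eval[OF g(1)]]
  have *: "?e (Poly_Mapping.single m c * q) = ?e (Poly_Mapping.single m c) * ?e q" for m c
    by (rule additive_eq_on_singles[where F="\<lambda>q. ?e (Poly_Mapping.single m c * q)"
          and G="\<lambda>q. ?e (Poly_Mapping.single m c) * ?e q"])
      (simp add: additive_def add distrib_left, simp add: additive_def add distrib_left,
        simp add: eval_single[OF g(1)] g(2) mult_single \<chi> mult_ac)
  show ?thesis
    by (rule additive_eq_on_singles[where F="\<lambda>p. ?e (p * q)" and G="\<lambda>p. ?e p * ?e q"])
      (simp_all add: additive_def add distrib_right * )
qed

section \<open>Noetherian rings\<close>

text \<open>Ideals are taken as submodules of the ring over itself, so that one notion of span
  serves ideals and vectors of polynomials.\<close>

definition noetherian :: "'a::comm_ring_1 itself \<Rightarrow> bool" where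
  "noetherian _ \<longleftrightarrow> (\<forall>I::'a set. Modules.module.subspace (*) I \<longrightarrow>
     (\<exists>S. finite S \<and> I = Modules.module.span (*) S))"

lemma module_times: "Modules.module ((*) :: 'a::comm_ring_1 \<Rightarrow> 'a \<Rightarrow> 'a)"
  by standard (simp_all add: algebra_simps)

text \<open>Induction on the generators. For a new generator \<open>x\<close>, the coefficients of
  \<open>x\<close> in elements of \<open>N\<close>, taken modulo \<open>span B\<close>, form an
  ideal. Lifts of its generators, together with generators of \<open>N \<inter> span B\<close>,
  generate \<open>N\<close>.\<close>

lemma (in Modules.module) noetherian_subspace_fg:
  assumes noeth: "noetherian TYPE('a)" and "finite B" "subspace N" "N \<subseteq> span B"
  shows "\<exists>S. finite S \<and> N = span S"
  using assms(2-)
proof (induction B arbitrary: N rule: finite_induct)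
  case empty
  then have "N = span {}" using subspace_0 by auto
  then show ?case by blast
next
  case (insert x B)
  interpret ring: Modules.module "(*) :: 'a \<Rightarrow> 'a \<Rightarrow> 'a" by (rule module_times)
  define I where "I = {r. \<exists>y\<in>span B. scale r x + y \<in> N}"
  have "ring.subspace I"
  proof (rule ring.subspaceI)
    show "0 \<in> I"
      using subspace_0[OF insert.prems(1)] span_zero by (force simp: I_def)
  next
    fix r s assume "r \<in> I" "s \<in> I"
    then obtain y z where yz: "y \<in> span B" "scale r x + y \<in> N" "z \<in> span B" "scale s x + z \<in> N"
      by (auto simp: I_def)
    have "scale (r + s) x + (y + z) \<in> N"
      using subspace_add[OF insert.prems(1) yz(2,4)] by (simp add: scale_left_distrib add_ac)
    with yz show "r + s \<in> I" by (auto simp: I_def intro: span_add)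
  next
    fix c r assume "r \<in> I"
    then obtain y where y: "y \<in> span B" "scale r x + y \<in> N" by (auto simp: I_def)
    have "scale (c * r) x + scale c y \<in> N"
      using subspace_scale[OF insert.prems(1) y(2), of c] by (simp add: scale_right_distrib)
    with y show "c * r \<in> I" by (auto simp: I_def intro: span_scale)
  qed
  then obtain T where T: "finite T" "I = ring.span T"
    using noeth unfolding noetherian_def by blast
  \<comment> \<open>One element of \<open>N\<close> above each generator of the coefficient
    ideal.\<close>
  have "\<forall>r\<in>T. \<exists>w\<in>N. w - scale r x \<in> span B"
  proof
    fix r assume "r \<in> T"
    then have "r \<in> I" using T ring.span_base by auto
    then obtain y where "y \<in> span B" "scale r x + y \<in> N" by (auto simp: I_def)
    then show "\<exists>w\<in>N. w - scale r x \<in> span B" by (intro bexI[of _ "scale r x + y"]) auto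
  qed
  then obtain w where w: "\<And>r. r \<in> T \<Longrightarrow> w r \<in> N" "\<And>r. r \<in> T \<Longrightarrow> w r - scale r x \<in> span B"
    by metis
  obtain S where S: "finite S" "N \<inter> span B = span S"
    using insert.IH[of "N \<inter> span B"] insert.prems(1) subspace_inter by auto
  have "N = span (w ` T \<union> S)"
  proof
    have "S \<subseteq> N" using S span_superset[of S] by blast
    then show "span (w ` T \<union> S) \<subseteq> N"
      using w(1) by (intro span_minimal[OF _ insert.prems(1)]) blast
  next
    \<comment> \<open>A combination of the generators of \<open>I\<close> lifts to the same
      combination of the \<open>w r\<close>; the errors stay in \<open>span B\<close>.\<close>
    have lift: "\<exists>u\<in>span (w ` T). u - scale r x \<in> span B" if "r \<in> ring.span T" for r
      using that
    proof (induction r rule: ring.span_induct_alt)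
      case base
      show ?case using span_zero by (intro bexI[of _ 0]) auto
    next
      case (step c r r')
      then obtain u where u: "u \<in> span (w ` T)" "u - scale r' x \<in> span B" by blast
      have "scale c (w r) + u - scale (c * r + r') x = scale c (w r - scale r x) + (u - scale r' x)"
        by (simp add: algebra_simps)
      with span_add[OF span_scale[OF w(2)[OF step(1)], of c] u(2)]
      have "scale c (w r) + u - scale (c * r + r') x \<in> span B" by argo
      moreover have "scale c (w r) + u \<in> span (w ` T)"
        using step(1) by (intro span_add[OF span_scale[OF span_base] u(1)]) simp
      ultimately show ?case by blast
    qed
    show "N \<subseteq> span (w ` T \<union> S)"
    proof
      fix v assume v: "v \<in> N"
      then have "v \<in> span (insert x B)" using insert.prems(2) by (rule subsetD[rotated])
      then obtain k where k: "v - scale k x \<in> span B"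
        unfolding span_breakdown_eq by (elim exE)
      have "scale k x + (v - scale k x) \<in> N" using v by simp
      then have "k \<in> I" unfolding I_def mem_Collect_eq by (rule bexI[OF _ k])
      \<comment> \<open>Subtracting the lift cancels the coefficient of \<open>x\<close>, so
        \<open>v - u\<close> lies in \<open>N \<inter> span B\<close>.\<close>
      then obtain u where u: "u \<in> span (w ` T)" "u - scale k x \<in> span B" using lift T(2) by blast
      have "span (w ` T) \<subseteq> N" using w(1) by (intro span_minimal[OF _ insert.prems(1)]) blast
      then have "v - u \<in> N" using u(1) v by (intro subspace_diff[OF insert.prems(1)]) auto
      moreover have "v - u \<in> span B" using span_diff[OF k u(2)] by simp
      ultimately have "v - u \<in> span S" using S by blast
      then have "v - u \<in> span (w ` T \<union> S)"
        using span_mono[of S "w ` T \<union> S"] by blast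
      moreover have "u \<in> span (w ` T \<union> S)"
        using u(1) span_mono[of "w ` T" "w ` T \<union> S"] by blast
      ultimately have "v - u + u \<in> span (w ` T \<union> S)" by (rule span_add)
      then show "v \<in> span (w ` T \<union> S)" by simp
    qed
  qed
  moreover have "finite (w ` T \<union> S)" using T(1) S(1) by simp
  ultimately show ?case by (intro exI conjI)
qed

text \<open>A nonzero element of least Euclidean size generates: a remainder modulo it is smaller
  and so vanishes.\<close>

lemma euclidean_ideal_principal:
  fixes I :: "'a::euclidean_ring set"
  assumes "Modules.module.subspace (*) I"
  shows "\<exists>g. I = Modules.module.span (*) {g}"
proof -
  interpret ring: Modules.module "(*) :: 'a \<Rightarrow> 'a \<Rightarrow> 'a" by (rule module_times)
  show ?thesis
  proof (cases "I = {0}")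
    case True
    then show ?thesis by (auto simp: ring.span_singleton intro!: exI[of _ 0])
  next
    case False
    then obtain x where "x \<in> I \<and> x \<noteq> 0" using ring.subspace_0[OF assms] by auto
    then obtain g where g: "g \<in> I" "g \<noteq> 0"
      and min: "\<And>y. y \<in> I \<Longrightarrow> y \<noteq> 0 \<Longrightarrow> euclidean_size g \<le> euclidean_size y"
      using ex_has_least_nat[of "\<lambda>x. x \<in> I \<and> x \<noteq> 0" x euclidean_size] by metis
    have "y \<in> ring.span {g}" if y: "y \<in> I" for y
    proof -
      have "y mod g = y - (y div g) * g" by (simp add: minus_div_mult_eq_mod)
      then have "y mod g \<in> I"
        using ring.subspace_diff[OF assms y] ring.subspace_scale[OF assms g(1)] by simp
      then have "y mod g = 0" using min[of "y mod g"] mod_size_less[OF g(2), of y] by linarith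
      then have "y = (y div g) * g" using div_mult_mod_eq[of y g] by simp
      then show ?thesis by (auto simp: ring.span_singleton)
    qed
    then show ?thesis using g(1) ring.span_minimal[of "{g}" I] assms by (intro exI[of _ g]) auto
  qed
qed

lemma noetherian_euclidean: "noetherian TYPE('a::euclidean_ring)"
  unfolding noetherian_def using euclidean_ideal_principal by blast

section \<open>Normal forms modulo quadratic relations\<close>

text \<open>The carrier of \<open>mpoly_ring\<close> as a plain set: computations run in the type
  class ring of all polynomials, and the record structure comes in for the quotient.\<close>

definition polys_in :: "'i set \<Rightarrow> (('i \<Rightarrow>\<^sub>0 nat) \<Rightarrow>\<^sub>0 'r::comm_ring_1) set" where
  "polys_in I = {p. \<forall>m\<in>Poly_Mapping.keys p. Poly_Mapping.keys m \<subseteq> I}"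

lemma single_in_polys_in: "Poly_Mapping.keys m \<subseteq> I \<Longrightarrow> Poly_Mapping.single m c \<in> polys_in I"
  by (simp add: polys_in_def)

lemma zero_in_polys_in: "0 \<in> polys_in I"
  by (simp add: polys_in_def)

lemma mpoly_const_in_polys_in: "mpoly_const c \<in> polys_in I"
  by (simp add: mpoly_const_def single_in_polys_in)

lemma add_in_polys_in: "p \<in> polys_in I \<Longrightarrow> q \<in> polys_in I \<Longrightarrow> p + q \<in> polys_in I"
  using keys_add[of p q] by (fastforce simp: polys_in_def)

lemma uminus_in_polys_in: "p \<in> polys_in I \<Longrightarrow> - p \<in> polys_in I"
  by (simp add: polys_in_def in_keys_iff)

lemma diff_in_polys_in: "p \<in> polys_in I \<Longrightarrow> q \<in> polys_in I \<Longrightarrow> p - q \<in> polys_in I"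
  using add_in_polys_in[of p I "- q"] uminus_in_polys_in by auto

lemma mult_in_polys_in:
  assumes "p \<in> polys_in I" "q \<in> polys_in I"
  shows "p * q \<in> polys_in I"
  unfolding polys_in_def
proof safe
  fix m v assume "m \<in> Poly_Mapping.keys (p * q)" and v: "v \<in> Poly_Mapping.keys m"
  then obtain k l where "k \<in> Poly_Mapping.keys p" "l \<in> Poly_Mapping.keys q" "m = k + l"
    using keys_mult[of p q] by auto
  with v keys_add[of k l] assms show "v \<in> I" by (fastforce simp: polys_in_def)
qed

lemma sum_in_polys_in: "(\<And>x. x \<in> A \<Longrightarrow> f x \<in> polys_in I) \<Longrightarrow> sum f A \<in> polys_in I"
  by (induction A rule: infinite_finite_induct) (auto simp: zero_in_polys_in add_in_polys_in)

lemma polys_in_mono: "I \<subseteq> I' \<Longrightarrow> polys_in I \<subseteq> polys_in I'"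
  by (auto simp: polys_in_def)

section \<open>Exponents modulo two and reduction to squarefree monomials\<close>

definition mono_eval :: "('i \<Rightarrow> 'r) \<Rightarrow> ('i \<Rightarrow>\<^sub>0 nat) \<Rightarrow> 'r::comm_monoid_mult" where
  "mono_eval a m = (\<Prod>v\<in>Poly_Mapping.keys m. a v ^ Poly_Mapping.lookup m v)"

lemma mono_eval_superset:
  "finite A \<Longrightarrow> Poly_Mapping.keys m \<subseteq> A \<Longrightarrow> mono_eval a m = (\<Prod>v\<in>A. a v ^ Poly_Mapping.lookup m v)"
  unfolding mono_eval_def by (intro prod.mono_neutral_left) (auto simp: in_keys_iff)

lemma mono_eval_add: "mono_eval a (m + n) = mono_eval a m * mono_eval a n"
proof -
  let ?A = "Poly_Mapping.keys m \<union> Poly_Mapping.keys n"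
  have A: "finite ?A" by simp
  show ?thesis
    using mono_eval_superset[OF A, of m a] mono_eval_superset[OF A, of n a]
      mono_eval_superset[OF A keys_add, of a]
    by (simp add: lookup_add power_add prod.distrib)
qed

lemma mono_eval_zero [simp]: "mono_eval a 0 = 1"
  by (simp add: mono_eval_def)

lemma mono_eval_single [simp]: "mono_eval a (Poly_Mapping.single v n) = a v ^ n"
  by (simp add: mono_eval_def)

definition mono_half :: "('i \<Rightarrow>\<^sub>0 nat) \<Rightarrow> 'i \<Rightarrow>\<^sub>0 nat" where
  "mono_half = Poly_Mapping.map (\<lambda>k. k div 2)"

definition mono_parity :: "('i \<Rightarrow>\<^sub>0 nat) \<Rightarrow> 'i \<Rightarrow>\<^sub>0 nat" where
  "mono_parity = Poly_Mapping.map (\<lambda>k. k mod 2)"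

definition mono_restrict :: "'i set \<Rightarrow> ('i \<Rightarrow>\<^sub>0 nat) \<Rightarrow> 'i \<Rightarrow>\<^sub>0 nat" where
  "mono_restrict A = Poly_Mapping.mapp (\<lambda>v k. if v \<in> A then k else 0)"

lemma lookup_mono_half [simp]: "Poly_Mapping.lookup (mono_half m) v = Poly_Mapping.lookup m v div 2"
  by (simp add: mono_half_def Poly_Mapping.map.rep_eq when_def)

lemma lookup_mono_parity [simp]: "Poly_Mapping.lookup (mono_parity m) v = Poly_Mapping.lookup m v mod 2"
  by (simp add: mono_parity_def Poly_Mapping.map.rep_eq when_def)

lemma lookup_mono_restrict [simp]:
  "Poly_Mapping.lookup (mono_restrict A m) v = (if v \<in> A then Poly_Mapping.lookup m v else 0)"
  by (simp add: mono_restrict_def lookup_mapp when_def in_keys_iff)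

lemma mono_restrict_split: "mono_restrict (- A) m + mono_restrict A m = m"
  by (rule poly_mapping_eqI) (simp add: lookup_add)

lemma mono_parity_half: "mono_parity m + (mono_half m + mono_half m) = m"
  by (rule poly_mapping_eqI) (simp add: lookup_add, presburger)

lemma keys_mono_parity: "Poly_Mapping.keys (mono_parity m) \<subseteq> Poly_Mapping.keys m"
  by (auto simp: in_keys_iff)

lemma keys_mono_half: "Poly_Mapping.keys (mono_half m) \<subseteq> Poly_Mapping.keys m"
  by (auto simp: in_keys_iff)

text \<open>The radicands \<open>a\<close> are given on the whole index type, so reduction is a
  total map without side conditions on the variables.\<close>

definition normal_form :: "('i \<Rightarrow> 'r) \<Rightarrow> (('i \<Rightarrow>\<^sub>0 nat) \<Rightarrow>\<^sub>0 'r) \<Rightarrow> ('i \<Rightarrow>\<^sub>0 nat) \<Rightarrow>\<^sub>0 'r::comm_ring_1" where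
  "normal_form a =
     lin_ext (\<lambda>m c. Poly_Mapping.single (mono_parity m) (c * mono_eval a (mono_half m)))"

lemma additive_normal_form: "additive (normal_form a)"
  unfolding normal_form_def
  by (intro additive_lin_ext) (simp add: additive_def single_add distrib_right)

lemma normal_form_single:
  "normal_form a (Poly_Mapping.single m c)
     = Poly_Mapping.single (mono_parity m) (c * mono_eval a (mono_half m))"
  unfolding normal_form_def
  by (intro lin_ext_single) (simp add: additive_def single_add distrib_right)

lemma normal_form_const_mult: "normal_form a (mpoly_const c * p) = mpoly_const c * normal_form a p"
  by (rule additive_eq_on_singles[where F="\<lambda>p. normal_form a (mpoly_const c * p)"
        and G="\<lambda>p. mpoly_const c * normal_form a p"])
    (simp add: additive_def additive.add[OF additive_normal_form] distrib_left,
      simp add: additive_def additive.add[OF additive_normal_form] distrib_left,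
      simp add: mpoly_const_def mult_single normal_form_single mult_ac)

lemma mpoly_var_squared: "mpoly_var v ^ 2 = Poly_Mapping.single (Poly_Mapping.single v 2) 1"
  by (simp add: mpoly_var_def power2_eq_square mult_single numeral_2_eq_2 flip: single_add)

text \<open>Multiplying a monomial by the square of \<open>v\<close> keeps all parities and raises
  the half exponent of \<open>v\<close> by one, which contributes exactly the scalar
  \<open>a v\<close>.\<close>

lemma normal_form_relation: "normal_form a (p * (mpoly_var v ^ 2 - mpoly_const (a v))) = 0"
proof -
  have *: "mono_parity (m + Poly_Mapping.single v 2) = mono_parity m"
    "mono_half (m + Poly_Mapping.single v 2) = mono_half m + Poly_Mapping.single v 1" for m
    by (rule poly_mapping_eqI; simp add: lookup_add lookup_single when_def)+
  show ?thesis
    by (rule additive_eq_on_singles[where G="\<lambda>p. 0"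
          and F="\<lambda>p. normal_form a (p * (mpoly_var v ^ 2 - mpoly_const (a v)))"])
      (simp add: additive_def additive.add[OF additive_normal_form] distrib_right,
        simp add: additive_def,
        simp add: additive.diff[OF additive_normal_form] mpoly_var_squared right_diff_distrib
          mpoly_const_def mult_single normal_form_single * mono_eval_add mult_ac)
qed

definition reduced_in :: "'i set \<Rightarrow> (('i \<Rightarrow>\<^sub>0 nat) \<Rightarrow>\<^sub>0 'r::comm_ring_1) set" where
  "reduced_in F = {p. \<forall>m\<in>Poly_Mapping.keys p.
     Poly_Mapping.keys m \<subseteq> F \<and> (\<forall>v. Poly_Mapping.lookup m v \<le> 1)}"

lemma reduced_in_subset: "reduced_in F \<subseteq> polys_in F"
  by (auto simp: reduced_in_def polys_in_def)

lemma zero_in_reduced_in: "0 \<in> reduced_in F"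
  by (simp add: reduced_in_def)

lemma add_in_reduced_in: "p \<in> reduced_in F \<Longrightarrow> q \<in> reduced_in F \<Longrightarrow> p + q \<in> reduced_in F"
  using keys_add[of p q] unfolding reduced_in_def by blast

lemma const_mult_in_reduced_in:
  assumes "p \<in> reduced_in F"
  shows "mpoly_const c * p \<in> reduced_in F"
proof -
  have "Poly_Mapping.keys (mpoly_const c * p) \<subseteq> Poly_Mapping.keys p"
    using keys_mult[of "mpoly_const c" p] by (auto simp: mpoly_const_def split: if_splits)
  then show ?thesis using assms by (auto simp: reduced_in_def)
qed

lemma normal_form_in_reduced_in:
  assumes "p \<in> polys_in F"
  shows "normal_form a p \<in> reduced_in F"
proof (induction p rule: poly_mapping_single_add_induct)
  case zero
  then show ?case by (simp add: additive.zero[OF additive_normal_form] zero_in_reduced_in)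
next
  case (single m c)
  then have "Poly_Mapping.keys m \<subseteq> F" using assms by (auto simp: polys_in_def)
  then show ?case
    using keys_mono_parity[of m] by (auto simp: normal_form_single reduced_in_def)
next
  case (add p q)
  then show ?case by (simp add: additive.add[OF additive_normal_form] add_in_reduced_in)
qed

text \<open>Squared variables are replaced by their radicands one at a time, each replacement
  changing the polynomial by an element of \<open>J\<close>. Only closure properties of
  \<open>J\<close> are assumed, so the ideal generated in a ring record can be inserted.\<close>

lemma normal_form_congruent:
  assumes p: "p \<in> polys_in I"
    and J: "0 \<in> J" "\<And>x y. x \<in> J \<Longrightarrow> y \<in> J \<Longrightarrow> x + y \<in> J"
      "\<And>x y. x \<in> polys_in I \<Longrightarrow> y \<in> J \<Longrightarrow> x * y \<in> J"
    and rel: "\<And>v. v \<in> I \<Longrightarrow> mpoly_var v ^ 2 - mpoly_const (a v) \<in> J"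
  shows "p - normal_form a p \<in> J"
proof -
  have keys2: "Poly_Mapping.keys (m + (h + h)) \<subseteq> I"
    if "Poly_Mapping.keys m \<subseteq> I" "Poly_Mapping.keys h \<subseteq> I" for m h :: "'a \<Rightarrow>\<^sub>0 nat"
    using that keys_add[of m "h + h"] keys_add[of h h] by auto
  \<comment> \<open>The induction runs over the exponent vector \<open>h\<close>, itself a finitely
    supported function. The remaining monomial \<open>m\<close> and the coefficient \<open>c\<close>
    are arbitrary because squares are moved into \<open>m\<close> and radicands into
    \<open>c\<close>. The support condition is carried along since the sum case knows nothing about
    its parts.\<close>
  have square: "Poly_Mapping.keys h \<subseteq> I \<and> (\<forall>m c. Poly_Mapping.keys m \<subseteq> I \<longrightarrow>
      Poly_Mapping.single (m + (h + h)) c - Poly_Mapping.single m (c * mono_eval a h) \<in> J)"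
    if "Poly_Mapping.keys h \<subseteq> I" for h
  proof (induction h rule: poly_mapping_single_add_induct)
    case zero
    then show ?case using J(1) by simp
  next
    case (single v k)
    then have v: "v \<in> I" using that by auto
    show ?case
    proof (induction k)
      case 0
      then show ?case using J(1) by simp
    next
      case (Suc k)
      let ?s = "Poly_Mapping.single v k"
      let ?h = "?s + ?s"
      let ?t = "Poly_Mapping.single v (Suc k)"
      have t: "?t + ?t = ?h + Poly_Mapping.single v 2"
        by (simp flip: single_add)
      have "Poly_Mapping.single (m + (?t + ?t)) c - Poly_Mapping.single m (c * mono_eval a ?t) \<in> J"
        if m: "Poly_Mapping.keys m \<subseteq> I" for m c
      proof -
        let ?rel = "mpoly_var v ^ 2 - mpoly_const (a v)"
        \<comment> \<open>Replace one square of \<open>v\<close> by \<open>a v\<close>, then the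
          remaining \<open>?h\<close> by the induction hypothesis; the sum telescopes.\<close>
        have "Poly_Mapping.single (m + ?h) c * ?rel \<in> J"
          using v by (intro J(3) rel single_in_polys_in keys2 m) auto
        moreover have "Poly_Mapping.single (m + ?h) (c * a v)
            - Poly_Mapping.single m (c * a v * mono_eval a ?s) \<in> J"
          using Suc.IH m by blast
        ultimately have "Poly_Mapping.single (m + ?h) c * ?rel +
            (Poly_Mapping.single (m + ?h) (c * a v)
              - Poly_Mapping.single m (c * a v * mono_eval a ?s)) \<in> J"
          by (rule J(2))
        also have "Poly_Mapping.single (m + ?h) c * ?rel +
            (Poly_Mapping.single (m + ?h) (c * a v)
              - Poly_Mapping.single m (c * a v * mono_eval a ?s))
            = Poly_Mapping.single (m + (?t + ?t)) c - Poly_Mapping.single m (c * mono_eval a ?t)"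
          unfolding t mpoly_var_squared mpoly_const_def
          by (simp add: right_diff_distrib mult_single add.assoc mult.assoc)
        finally show ?thesis .
      qed
      then show ?case using v by auto
    qed
  next
    case (add h k)
    have "Poly_Mapping.single (m + (h + k + (h + k))) c
        - Poly_Mapping.single m (c * mono_eval a (h + k)) \<in> J"
      if m: "Poly_Mapping.keys m \<subseteq> I" for m c
    proof -
      have "Poly_Mapping.single (m + (k + k) + (h + h)) c
          - Poly_Mapping.single (m + (k + k)) (c * mono_eval a h) \<in> J"
        using add keys2[OF m] by blast
      moreover have "Poly_Mapping.single (m + (k + k)) (c * mono_eval a h)
          - Poly_Mapping.single m (c * mono_eval a h * mono_eval a k) \<in> J"
        using add m by blast
      ultimately have "(Poly_Mapping.single (m + (k + k) + (h + h)) c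
          - Poly_Mapping.single (m + (k + k)) (c * mono_eval a h))
          + (Poly_Mapping.single (m + (k + k)) (c * mono_eval a h)
          - Poly_Mapping.single m (c * mono_eval a h * mono_eval a k)) \<in> J"
        by (rule J(2))
      then show ?thesis by (simp add: mono_eval_add add_ac mult.assoc)
    qed
    then show ?case using add keys_add[of h k] by blast
  qed
  show ?thesis
  proof (induction p rule: poly_mapping_single_add_induct)
    case zero
    then show ?case using J(1) by (simp add: additive.zero[OF additive_normal_form])
  next
    case (single m c)
    then have "Poly_Mapping.keys m \<subseteq> I" using p by (auto simp: polys_in_def)
    then have "Poly_Mapping.keys (mono_parity m) \<subseteq> I" "Poly_Mapping.keys (mono_half m) \<subseteq> I"
      using keys_mono_parity[of m] keys_mono_half[of m] by auto
    then have "Poly_Mapping.single (mono_parity m + (mono_half m + mono_half m)) c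
        - Poly_Mapping.single (mono_parity m) (c * mono_eval a (mono_half m)) \<in> J"
      using square by blast
    then show ?case by (simp add: mono_parity_half normal_form_single)
  next
    case (add p q)
    then show ?case
      using J(2)[of "p - normal_form a p" "q - normal_form a q"]
      by (simp add: additive.add[OF additive_normal_form] algebra_simps)
  qed
qed

section \<open>Coordinates with respect to the monomials outside a set of variables\<close>

text \<open>The coordinate at \<open>t\<close> of a polynomial that is regarded as a combination of
  monomials outside \<open>F\<close> with coefficients in the variables from
  \<open>F\<close>.\<close>

definition slice :: "'i set \<Rightarrow> ('i \<Rightarrow>\<^sub>0 nat) \<Rightarrow> (('i \<Rightarrow>\<^sub>0 nat) \<Rightarrow>\<^sub>0 'r) \<Rightarrow> ('i \<Rightarrow>\<^sub>0 nat) \<Rightarrow>\<^sub>0 'r::comm_ring_1" where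
  "slice F t =
     lin_ext (\<lambda>m c. if mono_restrict (- F) m = t then Poly_Mapping.single (mono_restrict F m) c else 0)"

lemma additive_slice: "additive (slice F t)"
  unfolding slice_def by (intro additive_lin_ext) (simp add: additive_def single_add)

lemma slice_single:
  "slice F t (Poly_Mapping.single m c)
     = (if mono_restrict (- F) m = t then Poly_Mapping.single (mono_restrict F m) c else 0)"
  unfolding slice_def by (intro lin_ext_single) (simp add: additive_def single_add)

lemma slice_decomposition:
  assumes "finite T" "mono_restrict (- F) ` Poly_Mapping.keys p \<subseteq> T"
  shows "(\<Sum>t\<in>T. Poly_Mapping.single t 1 * slice F t p) = p"
proof (rule additive_eq_on_singles[where G="\<lambda>p. p"])
  show "additive (\<lambda>p. \<Sum>t\<in>T. Poly_Mapping.single t 1 * slice F t p)"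
    by (simp add: additive_def additive.add[OF additive_slice] distrib_left sum.distrib)
  show "additive (\<lambda>p. p :: ('a \<Rightarrow>\<^sub>0 nat) \<Rightarrow>\<^sub>0 'b)" by (simp add: additive_def)
  fix m c assume "m \<in> Poly_Mapping.keys p"
  then have m: "mono_restrict (- F) m \<in> T" using assms by auto
  have "(\<Sum>t\<in>T. Poly_Mapping.single t 1 * slice F t (Poly_Mapping.single m c))
      = (\<Sum>t\<in>T. if mono_restrict (- F) m = t then Poly_Mapping.single m c else 0)"
    by (intro sum.cong) (auto simp: slice_single mult_single mono_restrict_split)
  also have "\<dots> = Poly_Mapping.single m c" using m assms(1) by simp
  finally show "(\<Sum>t\<in>T. Poly_Mapping.single t 1 * slice F t (Poly_Mapping.single m c))
      = Poly_Mapping.single m c" .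
qed

lemma slice_in_reduced_in:
  assumes "p \<in> reduced_in UNIV"
  shows "slice F t p \<in> reduced_in F"
proof (induction p rule: poly_mapping_single_add_induct)
  case zero
  then show ?case by (simp add: additive.zero[OF additive_slice] zero_in_reduced_in)
next
  case (single m c)
  then have "\<forall>v. Poly_Mapping.lookup m v \<le> 1" using assms by (auto simp: reduced_in_def)
  then show ?case by (auto simp: slice_single reduced_in_def in_keys_iff split: if_splits)
next
  case (add p q)
  then show ?case by (simp add: additive.add[OF additive_slice] add_in_reduced_in)
qed

text \<open>Slicing is linear over polynomials in \<open>F\<close>, even after reduction. Since
  \<open>p\<close> is reduced and \<open>g\<close> has no variables outside \<open>F\<close>, the
  exponents outside \<open>F\<close> stay at most one, so reduction acts on the part inside
  \<open>F\<close> alone.\<close>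

lemma slice_normal_form_mult:
  assumes p: "p \<in> reduced_in UNIV" and g: "g \<in> polys_in F"
  shows "slice F t (normal_form a (p * g)) = normal_form a (slice F t p * g)"
proof -
  note add = additive.add[OF additive_slice] additive.add[OF additive_normal_form]
  note zero = additive.zero[OF additive_slice] additive.zero[OF additive_normal_form]
  have monomial: "slice F t (normal_form a (Poly_Mapping.single m c * Poly_Mapping.single n d))
      = normal_form a (slice F t (Poly_Mapping.single m c) * Poly_Mapping.single n d)"
    if m: "\<And>v. Poly_Mapping.lookup m v \<le> 1" and n: "Poly_Mapping.keys n \<subseteq> F" for m n c d
  proof -
    have n0: "Poly_Mapping.lookup n v = 0" if "v \<notin> F" for v
      using n that by (auto simp: in_keys_iff)
    have m2: "Poly_Mapping.lookup m v div 2 = 0" "Poly_Mapping.lookup m v mod 2 = Poly_Mapping.lookup m v" for v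
      using m[of v] by auto
    have "mono_restrict (- F) (mono_parity (m + n)) = mono_restrict (- F) m"
      "mono_restrict F (mono_parity (m + n)) = mono_parity (mono_restrict F m + n)"
      "mono_half (m + n) = mono_half (mono_restrict F m + n)"
      by (rule poly_mapping_eqI; simp add: lookup_add n0 m2)+
    then show ?thesis
      by (simp add: mult_single normal_form_single slice_single zero)
  qed
  have "slice F t (normal_form a (Poly_Mapping.single m c * g))
      = normal_form a (slice F t (Poly_Mapping.single m c) * g)"
    if m: "m \<in> Poly_Mapping.keys p" for m c
  proof (rule additive_eq_on_singles[where F="\<lambda>g. slice F t (normal_form a (Poly_Mapping.single m c * g))"
        and G="\<lambda>g. normal_form a (slice F t (Poly_Mapping.single m c) * g)"])
    show "additive (\<lambda>g. slice F t (normal_form a (Poly_Mapping.single m c * g)))"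
      "additive (\<lambda>g. normal_form a (slice F t (Poly_Mapping.single m c) * g))"
      by (simp_all add: additive_def add distrib_left)
    fix n d assume "n \<in> Poly_Mapping.keys g"
    with m p g show "slice F t (normal_form a (Poly_Mapping.single m c * Poly_Mapping.single n d))
      = normal_form a (slice F t (Poly_Mapping.single m c) * Poly_Mapping.single n d)"
      by (intro monomial) (auto simp: reduced_in_def polys_in_def)
  qed
  then show ?thesis
    using additive_eq_on_singles[where F="\<lambda>p. slice F t (normal_form a (p * g))"
          and G="\<lambda>p. normal_form a (slice F t p * g)" and p=p]
    by (simp add: additive_def add distrib_right)
qed

lemma finite_reduced_monomials:
  assumes "finite F"
  shows "finite {m :: 'i \<Rightarrow>\<^sub>0 nat. Poly_Mapping.keys m \<subseteq> F \<and> (\<forall>v. Poly_Mapping.lookup m v \<le> 1)}"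
    (is "finite ?M")
proof -
  have "inj_on Poly_Mapping.keys ?M"
  proof (rule inj_onI)
    fix m n assume mn: "m \<in> ?M" "n \<in> ?M" "Poly_Mapping.keys m = Poly_Mapping.keys n"
    show "m = n"
    proof (rule poly_mapping_eqI)
      fix v
      have "Poly_Mapping.lookup m v \<le> 1" "Poly_Mapping.lookup n v \<le> 1" using mn by auto
      moreover have "Poly_Mapping.lookup m v = 0 \<longleftrightarrow> Poly_Mapping.lookup n v = 0"
        using mn(3) by (metis in_keys_iff)
      ultimately show "Poly_Mapping.lookup m v = Poly_Mapping.lookup n v" by linarith
    qed
  qed
  moreover have "Poly_Mapping.keys ` ?M \<subseteq> Pow F" by auto
  ultimately show ?thesis using assms by (meson finite_Pow_iff finite_subset inj_on_finite)
qed

text \<open>Vectors are functions on all natural numbers; those of length \<open>n\<close> are cut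
  out later by vanishing from \<open>n\<close> on. The scalars come from the base ring, where
  noetherianity is available.\<close>

lemma module_mpoly_vectors:
  "Modules.module (\<lambda>c (s :: nat \<Rightarrow> ('i \<Rightarrow>\<^sub>0 nat) \<Rightarrow>\<^sub>0 'r::comm_ring_1) k. mpoly_const c * s k)"
  by standard (simp_all add: fun_eq_iff mpoly_const_def single_add distrib_left distrib_right
      mult_single flip: mult.assoc)

lemma normal_form_idem:
  fixes a :: "'i \<Rightarrow> 'r::comm_ring_1"
  shows "normal_form a (normal_form a p) = normal_form a p"
proof (rule additive_eq_on_singles[where F="\<lambda>p. normal_form a (normal_form a p)"])
  show "additive (\<lambda>p. normal_form a (normal_form a p))"
    by (simp add: additive_def additive.add[OF additive_normal_form])
  show "additive (normal_form a)" by (rule additive_normal_form)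
  fix m :: "'i \<Rightarrow>\<^sub>0 nat" and c :: 'r
  have "mono_half (mono_parity m) = 0" "mono_parity (mono_parity m) = mono_parity m"
    by (rule poly_mapping_eqI; simp)+
  then show "normal_form a (normal_form a (Poly_Mapping.single m c))
      = normal_form a (Poly_Mapping.single m c)"
    by (simp add: normal_form_single)
qed

text \<open>On monomials, \<open>mono_half (m + n)\<close> is \<open>mono_half m\<close> plus the
  half exponent of \<open>mono_parity m + n\<close>, so the scalars collected in two rounds of
  reduction multiply to the right one. This makes the kernel of \<open>normal_form\<close> an
  ideal.\<close>

lemma normal_form_mult: "normal_form a (normal_form a p * q) = normal_form a (p * q)"
proof -
  note add = additive.add[OF additive_normal_form]
  have monomial: "normal_form a (normal_form a (Poly_Mapping.single m c) * Poly_Mapping.single n d)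
      = normal_form a (Poly_Mapping.single m c * Poly_Mapping.single n d)" for m c n d
  proof -
    have *: "mono_parity (mono_parity m + n) = mono_parity (m + n)"
      by (rule poly_mapping_eqI) (simp add: lookup_add mod_add_left_eq)
    have "mono_half (m + n) = mono_half m + mono_half (mono_parity m + n)"
      by (rule poly_mapping_eqI) (simp add: lookup_add, presburger)
    with * show ?thesis
      by (simp add: mult_single normal_form_single mono_eval_add) (simp add: mult_ac)
  qed
  have "normal_form a (normal_form a (Poly_Mapping.single m c) * q)
      = normal_form a (Poly_Mapping.single m c * q)" for m c
    using additive_eq_on_singles[where p=q
        and F="\<lambda>q. normal_form a (normal_form a (Poly_Mapping.single m c) * q)"
        and G="\<lambda>q. normal_form a (Poly_Mapping.single m c * q)"] monomial
    by (simp add: additive_def add distrib_left)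
  then show ?thesis
    using additive_eq_on_singles[where p=p and F="\<lambda>p. normal_form a (normal_form a p * q)"
        and G="\<lambda>p. normal_form a (p * q)"]
    by (simp add: additive_def add distrib_right)
qed

text \<open>The quotient is not mentioned: a set \<open>N\<close> that is closed under sums and
  multiples and contains all vectors vanishing in the quotient stands for the preimage of a
  submodule. A syzygy is a combination of its slices, and these are syzygies in a finite module over
  the noetherian ring.\<close>

lemma syzygies_finitely_generated:
  fixes a :: "'i \<Rightarrow> 'r::comm_ring_1" and g :: "nat \<Rightarrow> ('i \<Rightarrow>\<^sub>0 nat) \<Rightarrow>\<^sub>0 'r"
  assumes noeth: "noetherian TYPE('r)" and g: "\<And>k. k < n \<Longrightarrow> g k \<in> polys_in I"
  obtains S where "finite S"
    and "\<And>s. s \<in> S \<Longrightarrow> (\<forall>k. s k \<in> polys_in I) \<and> normal_form a (\<Sum>k<n. s k * g k) = 0"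
    and "\<And>N h. \<lbrakk>S \<subseteq> N; \<And>x y. x \<in> N \<Longrightarrow> y \<in> N \<Longrightarrow> x + y \<in> N;
        \<And>p x. p \<in> polys_in I \<Longrightarrow> x \<in> N \<Longrightarrow> (\<lambda>k. p * x k) \<in> N;
        \<And>x. (\<And>k. x k \<in> polys_in I \<and> normal_form a (x k) = 0) \<Longrightarrow> x \<in> N;
        \<And>k. h k \<in> polys_in I; \<And>k. n \<le> k \<Longrightarrow> h k = 0;
        normal_form a (\<Sum>k<n. h k * g k) = 0\<rbrakk> \<Longrightarrow> h \<in> N"
proof -
  define F where "F = (\<Union>k<n. \<Union>m\<in>Poly_Mapping.keys (g k). Poly_Mapping.keys m)"
  have F: "finite F" "F \<subseteq> I" using g by (auto simp: F_def polys_in_def)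
  have gF: "g k \<in> polys_in F" if "k < n" for k using that by (auto simp: F_def polys_in_def)
  note nf = additive.add[OF additive_normal_form] additive.zero[OF additive_normal_form]
    additive.sum[OF additive_normal_form] additive.diff[OF additive_normal_form]
  interpret vec: Modules.module
    "\<lambda>c (s :: nat \<Rightarrow> ('i \<Rightarrow>\<^sub>0 nat) \<Rightarrow>\<^sub>0 'r) k. mpoly_const c * s k"
    by (rule module_mpoly_vectors)
  \<comment> \<open>Reduced syzygies in the variables \<open>F\<close> are considered over the base
    ring, not over the polynomials in \<open>F\<close>, since a product of reduced polynomials need
    not be reduced.\<close>
  define M where "M = {s. (\<forall>k. s k \<in> reduced_in F) \<and> (\<forall>k\<ge>n. s k = 0) \<and>
    normal_form a (\<Sum>k<n. s k * g k) = 0}"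
  have M: "vec.subspace M"
  proof (rule vec.subspaceI)
    show "0 \<in> M" by (simp add: M_def zero_in_reduced_in nf)
    show "x + y \<in> M" if "x \<in> M" "y \<in> M" for x y
      using that by (simp add: M_def add_in_reduced_in distrib_right sum.distrib nf)
    show "(\<lambda>k. mpoly_const c * x k) \<in> M" if "x \<in> M" for c x
    proof -
      have "(\<Sum>k<n. mpoly_const c * x k * g k) = mpoly_const c * (\<Sum>k<n. x k * g k)"
        by (simp add: sum_distrib_left mult.assoc)
      then show ?thesis using that
        by (simp add: M_def const_mult_in_reduced_in normal_form_const_mult)
    qed
  qed
  define e where "e k p = (\<lambda>j. if j = k then p else 0)" for k :: nat and p :: "('i \<Rightarrow>\<^sub>0 nat) \<Rightarrow>\<^sub>0 'r"
  define mons where "mons = {m :: 'i \<Rightarrow>\<^sub>0 nat. Poly_Mapping.keys m \<subseteq> F \<and> (\<forall>v. Poly_Mapping.lookup m v \<le> 1)}"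
  define U where "U = (\<lambda>(k, m). e k (Poly_Mapping.single m 1)) ` ({..<n} \<times> mons)"
  have "finite U" unfolding U_def mons_def using finite_reduced_monomials[OF F(1)] by simp
  have eU: "e k p \<in> vec.span U" if k: "k < n" and p: "p \<in> reduced_in F" for k p
  proof (induction p rule: poly_mapping_single_add_induct)
    case zero
    have "e k 0 = 0" by (auto simp: e_def)
    then show ?case using vec.span_zero by (simp only:)
  next
    case (single m c)
    then have "m \<in> mons" using p by (auto simp: mons_def reduced_in_def)
    then have "e k (Poly_Mapping.single m 1) \<in> vec.span U"
      using k by (intro vec.span_base) (auto simp: U_def)
    from vec.span_scale[OF this, of c]
    show ?case by (simp add: e_def mpoly_const_def mult_single if_distrib cong: if_cong)
  next
    case (add p q)
    have "e k (p + q) = e k p + e k q" by (auto simp: e_def)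
    with add show ?case by (simp only: vec.span_add)
  qed
  have "M \<subseteq> vec.span U"
  proof
    fix s assume s: "s \<in> M"
    have "(\<lambda>k. if k < j then s k else 0) \<in> vec.span U" if "j \<le> n" for j
      using that
    proof (induction j)
      case 0
      have "(\<lambda>k. if k < 0 then s k else 0) = 0" by auto
      then show ?case using vec.span_zero by simp
    next
      case (Suc j)
      have "(\<lambda>k. if k < Suc j then s k else 0) = (\<lambda>k. if k < j then s k else 0) + e j (s j)"
        by (auto simp: e_def less_Suc_eq)
      then show ?case
        using Suc s vec.span_add[OF Suc.IH eU[of j "s j"]] by (simp add: M_def)
    qed
    from this[of n] have "(\<lambda>k. if k < n then s k else 0) \<in> vec.span U" by simp
    moreover have "(\<lambda>k. if k < n then s k else 0) = s" using s by (auto simp: M_def)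
    ultimately show "s \<in> vec.span U" by simp
  qed
  then obtain S where S: "finite S" "M = vec.span S"
    using vec.noetherian_subspace_fg[OF noeth \<open>finite U\<close> M] by metis
  show ?thesis
  proof (rule that[OF S(1)])
    fix s assume "s \<in> S"
    then have "s \<in> M" using S(2) vec.span_base by simp
    then show "(\<forall>k. s k \<in> polys_in I) \<and> normal_form a (\<Sum>k<n. s k * g k) = 0"
      using reduced_in_subset[of F] polys_in_mono[OF F(2)] by (auto simp: M_def)
  next
    fix N h
    assume SN: "S \<subseteq> N"
      and addN: "\<And>x y. x \<in> N \<Longrightarrow> y \<in> N \<Longrightarrow> x + y \<in> N"
      and multN: "\<And>p x. p \<in> polys_in I \<Longrightarrow> x \<in> N \<Longrightarrow> (\<lambda>k. p * x k) \<in> N"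
      and kerN: "\<And>x. (\<And>k. x k \<in> polys_in I \<and> normal_form a (x k) = 0) \<Longrightarrow> x \<in> N"
      and h: "\<And>k. h k \<in> polys_in I" "\<And>k. n \<le> k \<Longrightarrow> h k = 0"
        "normal_form a (\<Sum>k<n. h k * g k) = 0"
    have zeroN: "0 \<in> N" by (rule kerN) (simp add: zero_in_polys_in nf)
    have "vec.subspace N"
      using zeroN addN multN[OF mpoly_const_in_polys_in] by (intro vec.subspaceI)
    then have MN: "M \<subseteq> N" using S(2) vec.span_minimal[OF SN] by simp
    \<comment> \<open>Reducing each entry costs a vector that vanishes in the quotient, and
      \<open>N\<close> contains those.\<close>
    define h' where "h' k = normal_form a (h k)" for k
    have h': "h' k \<in> reduced_in I" for k
      unfolding h'_def by (rule normal_form_in_reduced_in[OF h(1)])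
    then have h'U: "h' k \<in> reduced_in UNIV" for k by (auto simp: reduced_in_def)
    have hh': "normal_form a (h k - h' k) = 0" for k by (simp add: nf h'_def normal_form_idem)
    have "normal_form a (\<Sum>k<n. h' k * g k) = 0"
      using h(3) by (simp add: h'_def nf normal_form_mult)
    \<comment> \<open>Each slice is again a syzygy because the \<open>g k\<close> involve no
      variables outside \<open>F\<close>.\<close>
    then have slice: "(\<lambda>k. slice F t (h' k)) \<in> N" for t
    proof -
      have "normal_form a (\<Sum>k<n. slice F t (h' k) * g k)
          = slice F t (normal_form a (\<Sum>k<n. h' k * g k))"
        by (simp add: nf additive.sum[OF additive_slice] slice_normal_form_mult[OF h'U gF])
      moreover have "h' k = 0" if "n \<le> k" for k
        using that by (simp add: h'_def h(2) nf)
      ultimately have "(\<lambda>k. slice F t (h' k)) \<in> M"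
        using slice_in_reduced_in[OF h'U] \<open>normal_form a (\<Sum>k<n. h' k * g k) = 0\<close>
        by (simp add: M_def additive.zero[OF additive_slice])
      then show ?thesis using MN by blast
    qed
    \<comment> \<open>All parts outside \<open>F\<close> that occur. Multiplying the slice at
      \<open>t\<close> by \<open>t\<close> and summing over \<open>T\<close> gives back
      \<open>h'\<close>.\<close>
    define T where "T = (\<Union>k<n. mono_restrict (- F) ` Poly_Mapping.keys (h' k))"
    have "finite T" by (simp add: T_def)
    have TI: "Poly_Mapping.keys t \<subseteq> I" if "t \<in> T" for t
      using that h' by (fastforce simp: T_def reduced_in_def in_keys_iff split: if_splits)
    have "(\<lambda>k. \<Sum>t\<in>T'. Poly_Mapping.single t 1 * slice F t (h' k)) \<in> N"
      if "finite T'" "T' \<subseteq> T" for T'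
      using that
    proof (induction T' rule: finite_induct)
      case empty
      then show ?case using zeroN by (simp add: zero_fun_def)
    next
      case (insert t T')
      then have "(\<lambda>k. Poly_Mapping.single t 1 * slice F t (h' k)) \<in> N"
        using multN[OF single_in_polys_in[OF TI] slice] by simp
      from addN[OF this insert.IH] insert show ?case by (simp add: plus_fun_def)
    qed
    from this[OF \<open>finite T\<close> order_refl]
    have "(\<lambda>k. \<Sum>t\<in>T. Poly_Mapping.single t 1 * slice F t (h' k)) \<in> N" .
    moreover have "(\<Sum>t\<in>T. Poly_Mapping.single t 1 * slice F t (h' k)) = h' k" for k
    proof (rule slice_decomposition[OF \<open>finite T\<close>])
      have "h' k = 0" if "n \<le> k" using that by (simp add: h'_def h(2) nf)
      then show "mono_restrict (- F) ` Poly_Mapping.keys (h' k) \<subseteq> T"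
        by (cases "k < n") (auto simp: T_def)
    qed
    ultimately have "h' \<in> N" by simp
    moreover have "h - h' \<in> N"
      using h(1) h' reduced_in_subset[of I] hh'
      by (intro kerN) (auto intro!: diff_in_polys_in)
    ultimately show "h \<in> N" using addN[of "h - h'" h'] by simp
  qed
qed

section \<open>Free modules and coherence\<close>

lemma free_module_simps [simp]:
  "carrier (free_module R n) = {..<n} \<rightarrow>\<^sub>E carrier R"
  "\<zero>\<^bsub>free_module R n\<^esub> = (\<lambda>i\<in>{..<n}. \<zero>\<^bsub>R\<^esub>)"
  "v \<oplus>\<^bsub>free_module R n\<^esub> w = (\<lambda>i\<in>{..<n}. v i \<oplus>\<^bsub>R\<^esub> w i)"
  "c \<odot>\<^bsub>free_module R n\<^esub> v = (\<lambda>i\<in>{..<n}. c \<otimes>\<^bsub>R\<^esub> v i)"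
  by (simp_all add: free_module_def)

lemma ideal_module_simps [simp]:
  "carrier (ideal_module R I) = I"
  "\<zero>\<^bsub>ideal_module R I\<^esub> = \<zero>\<^bsub>R\<^esub>"
  "v \<oplus>\<^bsub>ideal_module R I\<^esub> w = v \<oplus>\<^bsub>R\<^esub> w"
  "c \<odot>\<^bsub>ideal_module R I\<^esub> v = c \<otimes>\<^bsub>R\<^esub> v"
  by (simp_all add: ideal_module_def)

text \<open>\<open>submodule\<close> demands closure under the inverse of the additive group record,
  so that inverse has to be identified, which needs the group laws.\<close>

lemma (in cring) free_module_group: "group (add_monoid (free_module R n))"
proof (rule groupI)
  fix x assume x: "x \<in> carrier (add_monoid (free_module R n))"
  then have "(\<lambda>i\<in>{..<n}. \<ominus> x i) \<oplus>\<^bsub>free_module R n\<^esub> x = \<zero>\<^bsub>free_module R n\<^esub>"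
    by (auto simp: fun_eq_iff l_neg PiE_iff)
  moreover have "(\<lambda>i\<in>{..<n}. \<ominus> x i) \<in> carrier (add_monoid (free_module R n))"
    using x by (auto simp: PiE_iff)
  ultimately show "\<exists>y\<in>carrier (add_monoid (free_module R n)).
      y \<otimes>\<^bsub>add_monoid (free_module R n)\<^esub> x = \<one>\<^bsub>add_monoid (free_module R n)\<^esub>"
    by (intro bexI[of _ "\<lambda>i\<in>{..<n}. \<ominus> x i"]) (simp_all del: free_module_simps)
qed (auto simp: PiE_iff a_assoc fun_eq_iff extensional_def)

lemma (in cring) free_module_inv:
  assumes "x \<in> carrier (free_module R n)"
  shows "inv\<^bsub>add_monoid (free_module R n)\<^esub> x = (\<lambda>i\<in>{..<n}. \<ominus> x i)"
  using assms
  by (intro group.inv_equality[OF free_module_group]) (auto simp: fun_eq_iff l_neg PiE_iff)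

section \<open>Linear combinations as maps from a free module\<close>

definition lin_comb :: "('a, 'm) ring_scheme \<Rightarrow> nat \<Rightarrow> (nat \<Rightarrow> 'a) \<Rightarrow> (nat \<Rightarrow> 'a) \<Rightarrow> 'a" where
  "lin_comb R n g v = finsum R (\<lambda>i. v i \<otimes>\<^bsub>R\<^esub> g i) {..<n}"

context cring
begin

context
  fixes g :: "nat \<Rightarrow> 'a" and n :: nat
  assumes g: "\<And>i. i < n \<Longrightarrow> g i \<in> carrier R"
begin

lemma lin_comb_closed:
  assumes "v \<in> carrier (free_module R n)"
  shows "lin_comb R n g v \<in> carrier R"
  using assms g unfolding lin_comb_def by (intro finsum_closed) (auto simp: PiE_iff)

lemma lin_comb_add:
  assumes "v \<in> carrier (free_module R n)" "w \<in> carrier (free_module R n)"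
  shows "lin_comb R n g (v \<oplus>\<^bsub>free_module R n\<^esub> w) = lin_comb R n g v \<oplus> lin_comb R n g w"
proof -
  have "lin_comb R n g (v \<oplus>\<^bsub>free_module R n\<^esub> w) = finsum R (\<lambda>i. v i \<otimes> g i \<oplus> w i \<otimes> g i) {..<n}"
    unfolding lin_comb_def using assms g
    by (intro finsum_cong') (auto simp: PiE_iff l_distr)
  also have "\<dots> = lin_comb R n g v \<oplus> lin_comb R n g w"
    unfolding lin_comb_def using assms g by (intro finsum_addf) (auto simp: PiE_iff)
  finally show ?thesis .
qed

lemma lin_comb_smult:
  assumes "c \<in> carrier R" "v \<in> carrier (free_module R n)"
  shows "lin_comb R n g (c \<odot>\<^bsub>free_module R n\<^esub> v) = c \<otimes> lin_comb R n g v"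
proof -
  have "lin_comb R n g (c \<odot>\<^bsub>free_module R n\<^esub> v) = finsum R (\<lambda>i. c \<otimes> (v i \<otimes> g i)) {..<n}"
    unfolding lin_comb_def using assms g
    by (intro finsum_cong') (auto simp: PiE_iff m_assoc)
  also have "\<dots> = c \<otimes> lin_comb R n g v"
    unfolding lin_comb_def using assms g by (intro finsum_rdistr[symmetric]) (auto simp: PiE_iff)
  finally show ?thesis .
qed

lemma lin_comb_zero: "lin_comb R n g \<zero>\<^bsub>free_module R n\<^esub> = \<zero>"
proof -
  have "lin_comb R n g \<zero>\<^bsub>free_module R n\<^esub> = finsum R (\<lambda>i. \<zero>) {..<n}"
    unfolding lin_comb_def using g by (intro finsum_cong') auto
  then show ?thesis by simp
qed

lemma lin_comb_uminus:
  assumes "v \<in> carrier (free_module R n)"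
  shows "lin_comb R n g (\<lambda>i\<in>{..<n}. \<ominus> v i) = \<ominus> lin_comb R n g v"
proof -
  have "(\<lambda>i\<in>{..<n}. \<ominus> v i) = (\<ominus> \<one>) \<odot>\<^bsub>free_module R n\<^esub> v"
    using assms by (auto simp: fun_eq_iff PiE_iff l_minus)
  then show ?thesis
    using lin_comb_smult[OF _ assms, of "\<ominus> \<one>"] lin_comb_closed[OF assms] by (simp add: l_minus)
qed

text \<open>The image is an ideal, and unit vectors put the generators into it; conversely the
  generated ideal absorbs every partial sum.\<close>

lemma lin_comb_image: "lin_comb R n g ` carrier (free_module R n) = Idl (g ` {..<n})"
proof -
  let ?F = "free_module R n"
  let ?L = "lin_comb R n g ` carrier ?F"
  have "ideal ?L R"
  proof (rule idealI)
    show "ring R" by (rule ring_axioms)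
    show "subgroup ?L (add_monoid R)"
    proof (rule add.subgroupI)
      show "?L \<subseteq> carrier R" using lin_comb_closed by auto
      have "\<zero>\<^bsub>?F\<^esub> \<in> carrier ?F" by simp
      then show "?L \<noteq> {}" by blast
      fix x assume "x \<in> ?L"
      then obtain v where v: "v \<in> carrier ?F" "x = lin_comb R n g v" by blast
      have "(\<lambda>i\<in>{..<n}. \<ominus> v i) \<in> carrier ?F" using v(1) by (auto simp: PiE_iff)
      with lin_comb_uminus[OF v(1)] v show "\<ominus> x \<in> ?L" by (metis imageI)
      fix y assume "y \<in> ?L"
      then obtain w where w: "w \<in> carrier ?F" "y = lin_comb R n g w" by blast
      have "v \<oplus>\<^bsub>?F\<^esub> w \<in> carrier ?F" using v(1) w(1) by (auto simp: PiE_iff)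
      with lin_comb_add[OF v(1) w(1)] v w show "x \<oplus> y \<in> ?L" by (metis imageI)
    qed
  next
    fix x c assume "x \<in> ?L" and c: "c \<in> carrier R"
    then obtain v where v: "v \<in> carrier ?F" "x = lin_comb R n g v" by blast
    have "c \<odot>\<^bsub>?F\<^esub> v \<in> carrier ?F" using v(1) c by (auto simp: PiE_iff)
    with lin_comb_smult[OF c v(1)] v show "c \<otimes> x \<in> ?L" by (metis imageI)
    then show "x \<otimes> c \<in> ?L" using c v lin_comb_closed m_comm by metis
  qed
  moreover have "g ` {..<n} \<subseteq> ?L"
  proof safe
    fix k assume k: "k < n"
    let ?e = "\<lambda>i\<in>{..<n}. if i = k then \<one> else \<zero>"
    have "lin_comb R n g ?e = finsum R (\<lambda>i. if k = i then g i else \<zero>) {..<n}"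
      unfolding lin_comb_def using g by (intro finsum_cong') auto
    also have "\<dots> = g k" using k g by (intro add.finprod_singleton) auto
    finally show "g k \<in> ?L" by (intro image_eqI[of _ _ ?e]) auto
  qed
  ultimately have "Idl (g ` {..<n}) \<subseteq> ?L" by (intro genideal_minimal)
  moreover have "?L \<subseteq> Idl (g ` {..<n})"
  proof safe
    fix v assume v: "v \<in> carrier ?F"
    have gc: "g ` {..<n} \<subseteq> carrier R" using g by auto
    interpret I: ideal "Idl (g ` {..<n})" R by (rule genideal_ideal[OF gc])
    have gI: "g i \<in> Idl (g ` {..<n})" if "i < n" for i
      using genideal_self[OF gc] that by auto
    have "finsum R (\<lambda>i. v i \<otimes> g i) {..<m} \<in> Idl (g ` {..<n})" if "m \<le> n" for m
      using that
    proof (induction m)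
      case 0
      then show ?case by simp
    next
      case (Suc m)
      have "finsum R (\<lambda>i. v i \<otimes> g i) {..<Suc m} = v m \<otimes> g m \<oplus> finsum R (\<lambda>i. v i \<otimes> g i) {..<m}"
        using Suc.prems v g unfolding lessThan_Suc by (intro finsum_insert) (auto simp: PiE_iff)
      then show ?case
        using Suc v gI by (auto simp: PiE_iff intro!: I.a_closed I.I_l_closed)
    qed
    then show "lin_comb R n g v \<in> Idl (g ` {..<n})" by (simp add: lin_comb_def)
  qed
  ultimately show ?thesis by blast
qed

lemma lin_comb_kernel_submodule:
  "submodule {v \<in> carrier (free_module R n). lin_comb R n g v = \<zero>} R (free_module R n)"
proof -
  let ?F = "free_module R n"
  have 1: "v \<oplus>\<^bsub>?F\<^esub> w \<in> carrier ?F" if "v \<in> carrier ?F" "w \<in> carrier ?F" for v w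
    using that by (auto simp: PiE_iff)
  have 2: "c \<odot>\<^bsub>?F\<^esub> v \<in> carrier ?F" if "c \<in> carrier R" "v \<in> carrier ?F" for c v
    using that by (auto simp: PiE_iff)
  have 3: "(\<lambda>i\<in>{..<n}. \<ominus> v i) \<in> carrier ?F" if "v \<in> carrier ?F" for v
    using that by (auto simp: PiE_iff)
  have 4: "\<zero>\<^bsub>?F\<^esub> \<in> carrier ?F" by simp
  show ?thesis
    unfolding submodule_def submodule_axioms_def subgroup_def
    by (auto simp: 1 2 3 4 lin_comb_add lin_comb_smult lin_comb_zero lin_comb_uminus
        free_module_inv l_minus simp del: free_module_simps)
qed

end

text \<open>Coherence in terms of syzygies: sending unit vectors to the generators presents the
  ideal, with the syzygies as kernel. That \<open>S\<close> generates them is expressed by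
  minimality among submodules, matching \<open>fg_submodule\<close>.\<close>

lemma coherent_ringI:
  assumes syz: "\<And>n g. (\<And>i. i < n \<Longrightarrow> g i \<in> carrier R) \<Longrightarrow>
    \<exists>S. finite S \<and> S \<subseteq> {v \<in> carrier (free_module R n). lin_comb R n g v = \<zero>} \<and>
      (\<forall>N. submodule N R (free_module R n) \<longrightarrow> S \<subseteq> N \<longrightarrow>
        {v \<in> carrier (free_module R n). lin_comb R n g v = \<zero>} \<subseteq> N)"
  shows "coherent_ring R"
  unfolding coherent_ring_def
proof (intro conjI allI impI)
  show "cring R" by (rule cring_axioms)
  fix I assume "fg_ideal I R"
  then obtain G where G: "finite G" "G \<subseteq> carrier R" "I = Idl G" by (auto simp: fg_ideal_def)
  then obtain n and g :: "nat \<Rightarrow> 'a" where gG: "G = g ` {..<n}"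
    using finite_imp_nat_seg_image_inj_on[OF G(1)] by (metis lessThan_def)
  then have g: "g i \<in> carrier R" if "i < n" for i using G(2) that by auto
  let ?F = "free_module R n"
  let ?K = "{v \<in> carrier ?F. lin_comb R n g v = \<zero>}"
  have ex_S: "\<exists>S. finite S \<and> S \<subseteq> ?K \<and>
      (\<forall>N. submodule N R ?F \<longrightarrow> S \<subseteq> N \<longrightarrow> ?K \<subseteq> N)"
    by (rule syz) (rule g)
  obtain S where S: "finite S \<and> S \<subseteq> ?K \<and>
      (\<forall>N. submodule N R ?F \<longrightarrow> S \<subseteq> N \<longrightarrow> ?K \<subseteq> N)"
    using ex_S by (elim exE)
  have image: "lin_comb R n g ` carrier ?F = I"
    using lin_comb_image[OF g] G(3) gG by simp
  have "lin_comb R n g \<in> module_homs R ?F (ideal_module R I)"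
    using image lin_comb_add[OF g] lin_comb_smult[OF g]
    by (auto simp: module_homs_def simp del: free_module_simps)
  moreover have "fg_submodule ?K R ?F"
    unfolding fg_submodule_def
  proof (intro exI conjI)
    show "finite S" using S by (elim conjE)
    show "S \<subseteq> carrier ?F" using S by blast
    show "?K = \<Inter> {N. submodule N R ?F \<and> S \<subseteq> N}"
    proof (intro equalityI Inter_greatest Inter_lower)
      show "?K \<in> {N. submodule N R ?F \<and> S \<subseteq> N}"
        using S lin_comb_kernel_submodule[OF g] by simp
    qed (use S in simp)
  qed
  ultimately show "finitely_presented R (ideal_module R I)"
    unfolding finitely_presented_def using image
    by (intro exI[of _ n] bexI[of _ "lin_comb R n g"]) (simp_all del: free_module_simps)
qed

end

section \<open>The quotient ring\<close>

lemma mpoly_ring_simps [simp]: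
  "carrier (mpoly_ring I) = polys_in I"
  "p \<otimes>\<^bsub>mpoly_ring I\<^esub> q = p * q"
  "p \<oplus>\<^bsub>mpoly_ring I\<^esub> q = p + q"
  "\<zero>\<^bsub>mpoly_ring I\<^esub> = 0"
  "\<one>\<^bsub>mpoly_ring I\<^esub> = 1"
  by (simp_all add: mpoly_ring_def polys_in_def ring_of_type_algebra_def)

lemma one_in_polys_in: "1 \<in> polys_in I"
  by (simp add: polys_in_def)

lemma cring_mpoly_ring: "cring (mpoly_ring I)"
proof (rule cringI)
  show "abelian_group (mpoly_ring I)"
    by (rule abelian_groupI)
      (auto simp: zero_in_polys_in add_in_polys_in add_ac
        intro: bexI[of _ "- _"] uminus_in_polys_in left_minus)
  show "comm_monoid (mpoly_ring I)"
    by (rule comm_monoidI) (auto simp: one_in_polys_in mult_in_polys_in mult_ac)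
qed (simp add: distrib_right)

lemma mpoly_ring_uminus:
  assumes "p \<in> polys_in I"
  shows "\<ominus>\<^bsub>mpoly_ring I\<^esub> p = - p"
proof -
  interpret cring "mpoly_ring I" by (rule cring_mpoly_ring)
  show ?thesis
    using minus_equality[of "- p" p] assms uminus_in_polys_in[OF assms] by simp
qed

lemma mpoly_var_in_polys_in: "v \<in> I \<Longrightarrow> mpoly_var v \<in> polys_in I"
  by (simp add: mpoly_var_def single_in_polys_in)

definition square_relations :: "('i \<Rightarrow> 'r) \<Rightarrow> 'i set \<Rightarrow> (('i \<Rightarrow>\<^sub>0 nat) \<Rightarrow>\<^sub>0 'r::comm_ring_1) set" where
  "square_relations a I = (\<lambda>v. mpoly_var v ^ 2 - mpoly_const (a v)) ` I"

lemma square_relations_subset: "square_relations a I \<subseteq> polys_in I"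
  by (auto simp: square_relations_def power2_eq_square
      intro!: diff_in_polys_in mult_in_polys_in mpoly_var_in_polys_in mpoly_const_in_polys_in)

definition square_root_ring :: "('i \<Rightarrow> 'r) \<Rightarrow> 'i set \<Rightarrow> (('i \<Rightarrow>\<^sub>0 nat) \<Rightarrow>\<^sub>0 'r::comm_ring_1) set ring" where
  "square_root_ring a I = mpoly_ring I Quot (Idl\<^bsub>mpoly_ring I\<^esub> (square_relations a I))"

lemma ideal_normal_form_kernel: "ideal {p \<in> polys_in I. normal_form a p = 0} (mpoly_ring I)"
proof -
  interpret cring "mpoly_ring I" by (rule cring_mpoly_ring)
  note nf = additive.add[OF additive_normal_form] additive.zero[OF additive_normal_form]
    additive.minus[OF additive_normal_form]
  have mult: "normal_form a (p * q) = 0" if "normal_form a p = 0" for p q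
    using normal_form_mult[of a p q] that by (simp add: nf)
  show ?thesis
  proof (rule idealI)
    show "ring (mpoly_ring I)" by (rule ring_axioms)
    show "subgroup {p \<in> polys_in I. normal_form a p = 0} (add_monoid (mpoly_ring I))"
    proof (rule add.subgroupI)
      show "{p \<in> polys_in I. normal_form a p = 0} \<noteq> {}"
        using zero_in_polys_in[of I] by (auto simp: nf intro!: exI[of _ 0])
    qed (auto simp: nf mpoly_ring_uminus uminus_in_polys_in add_in_polys_in)
  qed (auto simp: mult mult_in_polys_in mult.commute[of _ "_ :: ('a \<Rightarrow>\<^sub>0 nat) \<Rightarrow>\<^sub>0 'b"])
qed

text \<open>The kernel is an ideal containing the relations; conversely \<open>p\<close> differs
  from its normal form by an element of the generated ideal. Membership in the ideal thereby becomes
  a computation.\<close>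

lemma genideal_square_relations:
  "Idl\<^bsub>mpoly_ring I\<^esub> (square_relations a I) = {p \<in> polys_in I. normal_form a p = 0}"
proof
  interpret cring "mpoly_ring I" by (rule cring_mpoly_ring)
  have "square_relations a I \<subseteq> {p \<in> polys_in I. normal_form a p = 0}"
    using square_relations_subset[of a I] normal_form_relation[of a 1]
    by (auto simp: square_relations_def)
  then show "Idl\<^bsub>mpoly_ring I\<^esub> (square_relations a I) \<subseteq> {p \<in> polys_in I. normal_form a p = 0}"
    by (intro genideal_minimal ideal_normal_form_kernel)
  have sub: "square_relations a I \<subseteq> carrier (mpoly_ring I)" using square_relations_subset by simp
  interpret J: ideal "Idl\<^bsub>mpoly_ring I\<^esub> (square_relations a I)" "mpoly_ring I"
    by (rule genideal_ideal[OF sub])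
  show "{p \<in> polys_in I. normal_form a p = 0} \<subseteq> Idl\<^bsub>mpoly_ring I\<^esub> (square_relations a I)"
  proof safe
    fix p assume p: "p \<in> polys_in I" "normal_form a p = 0"
    have "p - normal_form a p \<in> Idl\<^bsub>mpoly_ring I\<^esub> (square_relations a I)"
    proof (rule normal_form_congruent[OF p(1)])
      fix v assume "v \<in> I"
      then show "mpoly_var v ^ 2 - mpoly_const (a v) \<in> Idl\<^bsub>mpoly_ring I\<^esub> (square_relations a I)"
        using genideal_self[OF sub] by (auto simp: square_relations_def)
    qed (use J.zero_closed J.a_closed J.I_l_closed in simp_all)
    with p(2) show "p \<in> Idl\<^bsub>mpoly_ring I\<^esub> (square_relations a I)" by simp
  qed
qed

section \<open>Arithmetic in the quotient and its coherence\<close>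

locale square_root_quotient =
  fixes a :: "'i \<Rightarrow> 'r::comm_ring_1" and I :: "'i set"
begin

abbreviation "P \<equiv> mpoly_ring I :: (('i \<Rightarrow>\<^sub>0 nat) \<Rightarrow>\<^sub>0 'r) ring"
abbreviation "J \<equiv> {p \<in> polys_in I. normal_form a p = 0}"
abbreviation "Q \<equiv> square_root_ring a I"
abbreviation "proj \<equiv> (+>\<^bsub>P\<^esub>) J"

lemma Q_eq: "Q = P Quot J"
  by (simp add: square_root_ring_def genideal_square_relations)

sublocale J: ideal J P
  by (rule ideal_normal_form_kernel)

sublocale P: cring P
  by (rule cring_mpoly_ring)

sublocale Q: cring Q
  unfolding Q_eq by (rule J.quotient_is_cring[OF cring_mpoly_ring])

sublocale proj: ring_hom_cring P Q proj
  unfolding Q_eq by (rule J.rcos_ring_hom_cring[OF cring_mpoly_ring])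

lemma proj_simps:
  assumes "p \<in> polys_in I" "q \<in> polys_in I"
  shows "proj (p + q) = proj p \<oplus>\<^bsub>Q\<^esub> proj q" "proj (p * q) = proj p \<otimes>\<^bsub>Q\<^esub> proj q"
  using proj.hom_add[of p q] proj.hom_mult[of p q] assms by simp_all

lemma proj_closed: "p \<in> polys_in I \<Longrightarrow> proj p \<in> carrier Q"
  using proj.hom_closed by simp

lemma proj_surj: "x \<in> carrier Q \<Longrightarrow> \<exists>p\<in>polys_in I. proj p = x"
  unfolding Q_eq FactRing_def by (auto simp: A_RCOSETS_def')

lemma proj_eq_zero_iff:
  assumes "p \<in> polys_in I"
  shows "proj p = \<zero>\<^bsub>Q\<^esub> \<longleftrightarrow> normal_form a p = 0"
proof -
  have "proj p = J \<longleftrightarrow> p \<in> J"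
    using assms J.a_rcos_const J.rcos_const_imp_mem by auto
  then show ?thesis using assms by (simp add: Q_eq FactRing_def)
qed

lemma lin_comb_proj:
  assumes "\<And>k. k < n \<Longrightarrow> h k \<in> polys_in I" "\<And>k. k < n \<Longrightarrow> g k \<in> polys_in I"
    and "\<And>k. k < n \<Longrightarrow> v k = proj (h k)" "\<And>k. k < n \<Longrightarrow> w k = proj (g k)"
  shows "lin_comb Q n w v = proj (\<Sum>k<n. h k * g k)"
  unfolding lin_comb_def using assms
proof (induction n)
  case 0
  then show ?case using proj.hom_zero by simp
next
  case (Suc n)
  have "finsum Q (\<lambda>k. v k \<otimes>\<^bsub>Q\<^esub> w k) {..<Suc n}
      = v n \<otimes>\<^bsub>Q\<^esub> w n \<oplus>\<^bsub>Q\<^esub> finsum Q (\<lambda>k. v k \<otimes>\<^bsub>Q\<^esub> w k) {..<n}"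
    using Suc.prems unfolding lessThan_Suc by (intro Q.finsum_insert) (auto intro!: proj_closed)
  also have "\<dots> = proj (h n * g n) \<oplus>\<^bsub>Q\<^esub> proj (\<Sum>k<n. h k * g k)"
    using Suc by (simp add: proj_simps)
  also have "\<dots> = proj (h n * g n + (\<Sum>k<n. h k * g k))"
    using Suc.prems by (intro proj_simps[symmetric] mult_in_polys_in sum_in_polys_in) auto
  finally show ?case by (simp add: add.commute)
qed

lemma coherent:
  assumes noeth: "noetherian TYPE('r)"
  shows "coherent_ring Q"
proof (rule Q.coherent_ringI)
  fix n :: nat and g' assume g': "\<And>k. k < n \<Longrightarrow> g' k \<in> carrier Q"
  let ?F = "free_module Q n"
  let ?K = "{v \<in> carrier ?F. lin_comb Q n g' v = \<zero>\<^bsub>Q\<^esub>}"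
  have "\<forall>k\<in>{..<n}. \<exists>p\<in>polys_in I. proj p = g' k" using proj_surj g' by auto
  then obtain g where "\<forall>k\<in>{..<n}. g k \<in> polys_in I \<and> proj (g k) = g' k"
    using bchoice[of "{..<n}" "\<lambda>k p. p \<in> polys_in I \<and> proj p = g' k"] by blast
  then have g: "g k \<in> polys_in I" "g' k = proj (g k)" if "k < n" for k
    using that by auto
  define vec where "vec s = (\<lambda>k\<in>{..<n}. proj (s k))" for s :: "nat \<Rightarrow> ('i \<Rightarrow>\<^sub>0 nat) \<Rightarrow>\<^sub>0 'r"
  have vec: "vec s \<in> carrier ?F" if "\<And>k. s k \<in> polys_in I" for s
    using that by (auto simp: vec_def intro!: proj_closed)
  have lin_comb_vec: "lin_comb Q n g' (vec s) = \<zero>\<^bsub>Q\<^esub> \<longleftrightarrow> normal_form a (\<Sum>k<n. s k * g k) = 0"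
    if "\<And>k. s k \<in> polys_in I" for s
  proof -
    have "lin_comb Q n g' (vec s) = proj (\<Sum>k<n. s k * g k)"
      using that g by (intro lin_comb_proj) (auto simp: vec_def)
    moreover have "(\<Sum>k<n. s k * g k) \<in> polys_in I"
      using that g by (intro sum_in_polys_in mult_in_polys_in) auto
    ultimately show ?thesis by (simp add: proj_eq_zero_iff)
  qed
  show "\<exists>S. finite S \<and> S \<subseteq> ?K \<and> (\<forall>N. submodule N Q ?F \<longrightarrow> S \<subseteq> N \<longrightarrow> ?K \<subseteq> N)"
  proof (rule syzygies_finitely_generated[where n=n and g=g and I=I and a=a, OF noeth g(1)])
    fix S assume S: "finite S"
      "\<And>s. s \<in> S \<Longrightarrow> (\<forall>k. s k \<in> polys_in I) \<and> normal_form a (\<Sum>k<n. s k * g k) = 0"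
      and gen: "\<And>N h. \<lbrakk>S \<subseteq> N; \<And>x y. x \<in> N \<Longrightarrow> y \<in> N \<Longrightarrow> x + y \<in> N;
        \<And>p x. p \<in> polys_in I \<Longrightarrow> x \<in> N \<Longrightarrow> (\<lambda>k. p * x k) \<in> N;
        \<And>x. (\<And>k. x k \<in> polys_in I \<and> normal_form a (x k) = 0) \<Longrightarrow> x \<in> N;
        \<And>k. h k \<in> polys_in I; \<And>k. n \<le> k \<Longrightarrow> h k = 0;
        normal_form a (\<Sum>k<n. h k * g k) = 0\<rbrakk> \<Longrightarrow> h \<in> N"
    show "\<exists>S. finite S \<and> S \<subseteq> ?K \<and> (\<forall>N. submodule N Q ?F \<longrightarrow> S \<subseteq> N \<longrightarrow> ?K \<subseteq> N)"
    proof (intro exI conjI allI impI)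
      show "finite (vec ` S)" using S(1) by simp
      show "vec ` S \<subseteq> ?K"
      proof (intro image_subsetI CollectI conjI)
        fix s assume "s \<in> S"
        with S(2) have s: "\<And>k. s k \<in> polys_in I" "normal_form a (\<Sum>k<n. s k * g k) = 0" by blast+
        show "vec s \<in> carrier ?F" by (rule vec[OF s(1)])
        show "lin_comb Q n g' (vec s) = \<zero>\<^bsub>Q\<^esub>" using lin_comb_vec[OF s(1)] s(2) by simp
      qed
      fix N assume N: "submodule N Q ?F" and SN: "vec ` S \<subseteq> N"
      interpret N: submodule N Q ?F by (rule N)
      \<comment> \<open>Pulling \<open>N\<close> back to representatives gives a set of the kind
        that the syzygy lemma accepts.\<close>
      define N' where "N' = {x. (\<forall>k. x k \<in> polys_in I) \<and> vec x \<in> N}"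
      show "?K \<subseteq> N"
      proof
        fix v assume v: "v \<in> ?K"
        have "\<forall>k\<in>{..<n}. \<exists>p\<in>polys_in I. proj p = v k" using v by (intro ballI proj_surj) (auto simp: PiE_iff)
        then obtain h0 where h0: "\<forall>k\<in>{..<n}. h0 k \<in> polys_in I \<and> proj (h0 k) = v k"
          using bchoice[of "{..<n}" "\<lambda>k p. p \<in> polys_in I \<and> proj p = v k"] by blast
        define h where "h k = (if k < n then h0 k else 0)" for k
        have h: "\<And>k. h k \<in> polys_in I" "\<And>k. n \<le> k \<Longrightarrow> h k = 0"
          using h0 by (auto simp: h_def zero_in_polys_in)
        have vh: "vec h = v"
          using v h0 by (auto simp: vec_def h_def fun_eq_iff PiE_iff extensional_def)
        have "h \<in> N'"
        proof (rule gen)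
          show "S \<subseteq> N'" using S(2) SN by (auto simp: N'_def)
          fix x y assume xy: "x \<in> N'" "y \<in> N'"
          have "vec (x + y) = vec x \<oplus>\<^bsub>?F\<^esub> vec y"
            using xy by (auto simp: vec_def N'_def fun_eq_iff proj_simps)
          also have "\<dots> \<in> N" using N.m_closed xy by (simp add: N'_def)
          finally show "x + y \<in> N'" using xy by (simp add: N'_def add_in_polys_in)
        next
          fix p :: "('i \<Rightarrow>\<^sub>0 nat) \<Rightarrow>\<^sub>0 'r" and x
          assume px: "p \<in> polys_in I" "x \<in> N'"
          have "vec (\<lambda>k. p * x k) = proj p \<odot>\<^bsub>?F\<^esub> vec x"
            using px by (auto simp: vec_def N'_def fun_eq_iff proj_simps)
          also have "\<dots> \<in> N" using px by (intro N.smult_closed proj_closed) (auto simp: N'_def)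
          finally show "(\<lambda>k. p * x k) \<in> N'" using px by (simp add: N'_def mult_in_polys_in)
        next
          fix x :: "nat \<Rightarrow> ('i \<Rightarrow>\<^sub>0 nat) \<Rightarrow>\<^sub>0 'r"
          assume x: "\<And>k. x k \<in> polys_in I \<and> normal_form a (x k) = 0"
          then have "vec x = \<zero>\<^bsub>?F\<^esub>"
            using proj_eq_zero_iff by (auto simp: vec_def fun_eq_iff)
          also have "\<dots> \<in> N" using N.one_closed by simp
          finally show "x \<in> N'" using x by (simp add: N'_def)
        next
          show "normal_form a (\<Sum>k<n. h k * g k) = 0"
            using lin_comb_vec[of h, OF h(1)] v vh by simp
        qed (use h in auto)
        then show "v \<in> N" using vh by (simp add: N'_def)
      qed
    qed
  qed (simp_all add: g)
qed

text \<open>The kernel of a multiplicative map into an integral domain is prime; \<open>one\<close>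
  keeps it proper.\<close>

lemma domain_if_eval:
  fixes \<phi> :: "(('i \<Rightarrow>\<^sub>0 nat) \<Rightarrow>\<^sub>0 'r) \<Rightarrow> 'l::idom"
  assumes mult: "\<And>p q. \<phi> (p * q) = \<phi> p * \<phi> q" and one: "\<phi> 1 \<noteq> 0"
    and kernel: "\<And>p. p \<in> polys_in I \<Longrightarrow> \<phi> p = 0 \<longleftrightarrow> normal_form a p = 0"
  shows "domain Q"
proof -
  have "primeideal J P"
  proof (rule primeidealI)
    show "carrier P \<noteq> J"
      using one kernel[OF one_in_polys_in] one_in_polys_in[of I] by auto
    fix p q assume "p \<in> carrier P" "q \<in> carrier P" "p \<otimes>\<^bsub>P\<^esub> q \<in> J"
    then show "p \<in> J \<or> q \<in> J"
      using kernel[of "p * q"] kernel[of p] kernel[of q] mult[of p q] by auto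
  qed (rule J.is_ideal P.is_cring)+
  then show ?thesis unfolding Q_eq by (rule primeideal.quotient_is_domain)
qed

end

section \<open>Square roots over a field\<close>

text \<open>A predicate on subsets that is stable under intersections, so that
  \<open>is_subfield hull A\<close> is the subfield generated by \<open>A\<close>. Zero needs no
  exception because \<open>inverse 0 = 0\<close>.\<close>

definition is_subfield :: "'l::field set \<Rightarrow> bool" where
  "is_subfield K \<longleftrightarrow> 1 \<in> K \<and> (\<forall>x\<in>K. \<forall>y\<in>K. x - y \<in> K \<and> x * y \<in> K) \<and> (\<forall>x\<in>K. inverse x \<in> K)"

lemma is_subfieldD:
  assumes "is_subfield K"
  shows "0 \<in> K" "1 \<in> K" "x \<in> K \<Longrightarrow> - x \<in> K" "x \<in> K \<Longrightarrow> y \<in> K \<Longrightarrow> x + y \<in> K"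
    "x \<in> K \<Longrightarrow> y \<in> K \<Longrightarrow> x - y \<in> K" "x \<in> K \<Longrightarrow> y \<in> K \<Longrightarrow> x * y \<in> K"
    "x \<in> K \<Longrightarrow> inverse x \<in> K" "x \<in> K \<Longrightarrow> y \<in> K \<Longrightarrow> x / y \<in> K" "x \<in> K \<Longrightarrow> x ^ k \<in> K"
proof -
  note D = assms[unfolded is_subfield_def]
  show 1: "1 \<in> K" and minus: "x \<in> K \<Longrightarrow> y \<in> K \<Longrightarrow> x - y \<in> K" for x y using D by auto
  show 0: "0 \<in> K" using minus[OF 1 1] by simp
  show neg: "x \<in> K \<Longrightarrow> - x \<in> K" for x using minus[OF 0] by fastforce
  show "x \<in> K \<Longrightarrow> y \<in> K \<Longrightarrow> x + y \<in> K" using minus[of x "- y"] neg by simp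
  show mult: "x \<in> K \<Longrightarrow> y \<in> K \<Longrightarrow> x * y \<in> K" for x y using D by auto
  show inv: "x \<in> K \<Longrightarrow> inverse x \<in> K" for x using D by auto
  show "x \<in> K \<Longrightarrow> y \<in> K \<Longrightarrow> x / y \<in> K" using mult inv by (simp add: divide_inverse)
  show "x \<in> K \<Longrightarrow> x ^ k \<in> K" by (induction k) (auto simp: 1 mult)
qed

lemma is_subfield_prod: "is_subfield K \<Longrightarrow> (\<And>x. x \<in> A \<Longrightarrow> f x \<in> K) \<Longrightarrow> prod f A \<in> K"
  by (induction A rule: infinite_finite_induct) (auto simp: is_subfieldD)

lemma is_subfield_sum: "is_subfield K \<Longrightarrow> (\<And>x. x \<in> A \<Longrightarrow> f x \<in> K) \<Longrightarrow> sum f A \<in> K"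
  by (induction A rule: infinite_finite_induct) (auto simp: is_subfieldD)

lemma is_subfield_hull: "is_subfield (is_subfield hull A)"
  by (rule hull_in) (auto simp: is_subfield_def)

lemma is_subfield_adjoin_sqrt:
  assumes E: "is_subfield E" and d: "d ^ 2 \<in> E"
  shows "is_subfield {x + y * d | x y. x \<in> E \<and> y \<in> E}" (is "is_subfield ?E'")
proof -
  note E' = is_subfieldD[OF E]
  have EE': "x \<in> ?E'" if "x \<in> E" for x
    using that E'(1) by force
  have mult: "u * w \<in> ?E'" if u: "u \<in> ?E'" and w: "w \<in> ?E'" for u w
  proof -
    obtain x y x' y' where xy: "x \<in> E" "y \<in> E" "x' \<in> E" "y' \<in> E" "u = x + y * d" "w = x' + y' * d"
      using u w by blast
    have "u * w = (x * x' + y * y' * d ^ 2) + (x * y' + y * x') * d"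
      by (simp add: xy algebra_simps power2_eq_square)
    moreover have "x * x' + y * y' * d ^ 2 \<in> E" "x * y' + y * x' \<in> E"
      using xy d by (simp_all add: E')
    ultimately show ?thesis by blast
  qed
  show ?thesis
    unfolding is_subfield_def
  proof (intro conjI ballI)
    show "1 \<in> ?E'" by (rule EE'[OF E'(2)])
    fix u w assume u: "u \<in> ?E'" and w: "w \<in> ?E'"
    show "u * w \<in> ?E'" by (rule mult[OF u w])
    obtain x y x' y' where xy: "x \<in> E" "y \<in> E" "x' \<in> E" "y' \<in> E" "u = x + y * d" "w = x' + y' * d"
      using u w by blast
    have "u - w = (x - x') + (y - y') * d" by (simp add: xy algebra_simps)
    moreover have "x - x' \<in> E" "y - y' \<in> E" using xy by (simp_all add: E')
    ultimately show "u - w \<in> ?E'" by blast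
  next
    fix u assume "u \<in> ?E'"
    then obtain x y where xy: "x \<in> E" "y \<in> E" "u = x + y * d" by blast
    show "inverse u \<in> ?E'"
    \<comment> \<open>The inverse is found through the conjugate \<open>x - y * d\<close>. It can
      vanish for nonzero \<open>u\<close>, because \<open>d\<close> may already lie in
      \<open>E\<close>; then \<open>u\<close> is twice \<open>x\<close>.\<close>
    proof (cases "x - y * d = 0")
      case True
      then have u: "u = x + x" using xy by (simp add: algebra_simps)
      show ?thesis unfolding u using xy(1) by (intro EE' E'(4,7))
    next
      case False
      have "u * (x - y * d) = x ^ 2 - y ^ 2 * d ^ 2"
        by (simp add: xy algebra_simps power2_eq_square)
      \<comment> \<open>For \<open>u = 0\<close> this holds by the convention
        \<open>inverse 0 = 0\<close>.\<close>
      moreover have "inverse u = (x - y * d) * inverse (u * (x - y * d))"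
        using False by (cases "u = 0") (simp_all add: inverse_mult_distrib)
      ultimately have "inverse u = (x - y * d) * inverse (x ^ 2 - y ^ 2 * d ^ 2)" by simp
      also have "x - y * d = x + (- y) * d" by simp
      also have "(x + (- y) * d) * inverse (x ^ 2 - y ^ 2 * d ^ 2) \<in> ?E'"
      proof (rule mult)
        show "x + (- y) * d \<in> ?E'" using xy E'(3) by blast
        show "inverse (x ^ 2 - y ^ 2 * d ^ 2) \<in> ?E'" using xy d by (intro EE') (simp add: E')
      qed
      finally show ?thesis .
    qed
  qed
qed

lemma hull_insert_sqrtE:
  assumes "c \<in> is_subfield hull (K \<union> insert d A)" "d ^ 2 \<in> K"
  obtains x y where "x \<in> is_subfield hull (K \<union> A)" "y \<in> is_subfield hull (K \<union> A)" "c = x + y * d"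
proof -
  let ?E = "is_subfield hull (K \<union> A)"
  have E: "is_subfield ?E" by (rule is_subfield_hull)
  note E' = is_subfieldD[OF E]
  have KA: "K \<union> A \<subseteq> ?E" by (rule hull_subset)
  have "is_subfield {x + y * d | x y. x \<in> ?E \<and> y \<in> ?E}"
    using is_subfield_adjoin_sqrt[OF E] KA assms(2) by blast
  moreover have "K \<union> insert d A \<subseteq> {x + y * d | x y. x \<in> ?E \<and> y \<in> ?E}"
  proof
    fix u assume "u \<in> K \<union> insert d A"
    then consider "u = d" | "u \<in> ?E" using KA by blast
    then show "u \<in> {x + y * d | x y. x \<in> ?E \<and> y \<in> ?E}"
    proof cases
      case 1
      then have "u = 0 + 1 * d" by simp
      then show ?thesis using E'(1,2) by blast
    next
      case 2
      have "u = u + 0 * d" by simp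
      then show ?thesis using 2 E'(1) by blast
    qed
  qed
  ultimately have "is_subfield hull (K \<union> insert d A) \<subseteq> {x + y * d | x y. x \<in> ?E \<and> y \<in> ?E}"
    by (intro hull_minimal)
  with assms(1) that show thesis by blast
qed

section \<open>Besicovitch: independence of products of square roots\<close>

text \<open>If \<open>c v = x + y * c w\<close> over the field generated by the roots in
  \<open>F\<close>, squaring expresses \<open>c w\<close> through that field, unless
  \<open>y = 0\<close> and \<open>c v\<close> lies there, or \<open>x = 0\<close> and
  \<open>c v * c w\<close> does. The induction hypothesis excludes all three, which is why both
  \<open>v\<close> and \<open>c\<close> vary in it. Dividing by \<open>2 * x * y\<close> is where 2
  must be nonzero.\<close>

lemma sqrt_notin_multiquadratic:
  fixes c :: "'i \<Rightarrow> 'l::field"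
  assumes two: "(2::'l) \<noteq> 0" and K: "is_subfield K"
    and "finite F" "v \<notin> F"
    and "\<And>u. u \<in> insert v F \<Longrightarrow> c u ^ 2 \<in> K"
    and "\<And>S. S \<subseteq> insert v F \<Longrightarrow> S \<noteq> {} \<Longrightarrow> prod c S \<notin> K"
  shows "c v \<notin> is_subfield hull (K \<union> c ` F)"
  using assms(3-)
proof (induction F arbitrary: c v rule: finite_induct)
  case empty
  have "is_subfield hull K = K" using K by (rule hull_same)
  moreover have "c v \<notin> K" using empty.prems(3)[of "{v}"] by simp
  ultimately show ?case by simp
next
  case (insert w F)
  let ?E = "is_subfield hull (K \<union> c ` F)"
  have E: "is_subfield ?E" by (rule is_subfield_hull)
  note E' = is_subfieldD[OF E]
  have KE: "K \<subseteq> ?E" using hull_subset[of "K \<union> c ` F" is_subfield] by blast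
  have v: "v \<noteq> w" "v \<notin> F" using insert.prems(1) by auto
  have w: "c w \<notin> ?E"
    using insert.hyps(2) by (intro insert.IH insert.prems) auto
  have v': "c v \<notin> ?E"
    using v by (intro insert.IH insert.prems) auto
  have vw: "c v * c w \<notin> ?E"
  proof -
    \<comment> \<open>The product is treated as one square root at index \<open>v\<close>: a
      subproduct over \<open>S\<close> containing it is the old subproduct over
      \<open>insert w S\<close>.\<close>
    let ?c = "c(v := c v * c w)"
    have img: "?c ` F = c ` F" using v(2) by (intro image_cong) auto
    have "?c v \<notin> is_subfield hull (K \<union> ?c ` F)"
    proof (rule insert.IH[OF v(2)])
      fix u assume "u \<in> insert v F"
      then show "?c u ^ 2 \<in> K"
        using insert.prems(2)[of u] insert.prems(2)[of v] insert.prems(2)[of w]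
        by (auto simp: power_mult_distrib intro: is_subfieldD[OF K])
    next
      fix S assume S: "S \<subseteq> insert v F" "S \<noteq> {}"
      show "prod ?c S \<notin> K"
      proof (cases "v \<in> S")
        case True
        have fin: "finite S" using S(1) insert.hyps(1) finite_subset by blast
        have wS: "w \<notin> S" using S(1) insert.hyps(2) v(1) by auto
        have "prod ?c S = ?c v * prod ?c (S - {v})"
          using True fin by (simp add: prod.remove)
        also have "prod ?c (S - {v}) = prod c (S - {v})" by (intro prod.cong) auto
        also have "?c v * prod c (S - {v}) = prod c (insert w S)"
          using True fin wS prod.remove[OF fin True, of c] by (simp add: mult_ac)
        finally show ?thesis using insert.prems(3)[of "insert w S"] S(1) by auto
      next
        case False
        then have "prod ?c S = prod c S" by (intro prod.cong) auto
        then show ?thesis using insert.prems(3)[of S] S by auto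
      qed
    qed
    then show ?thesis unfolding img by simp
  qed
  show ?case
  proof
    assume "c v \<in> is_subfield hull (K \<union> c ` insert w F)"
    then have "c v \<in> is_subfield hull (K \<union> insert (c w) (c ` F))" by simp
    then obtain x y where xy: "x \<in> ?E" "y \<in> ?E" "c v = x + y * c w"
      using insert.prems(2)[of w] by (elim hull_insert_sqrtE) auto
    have w2: "c w ^ 2 \<in> ?E" and v2: "c v ^ 2 \<in> ?E"
      using insert.prems(2)[of v] insert.prems(2)[of w] KE by auto
    consider "y = 0" | "x = 0" | "x \<noteq> 0" "y \<noteq> 0" by blast
    then show False
    proof cases
      case 1
      then show ?thesis using xy v' by simp
    next
      case 2
      then have "c v * c w = y * c w ^ 2" using xy by (simp add: power2_eq_square)
      then show ?thesis using xy w2 vw by (simp add: E')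
    next
      case 3
      have "c w * (2 * x * y) = c v ^ 2 - x ^ 2 - y ^ 2 * c w ^ 2"
        by (simp add: xy power2_eq_square algebra_simps)
      then have "c w = (c v ^ 2 - x ^ 2 - y ^ 2 * c w ^ 2) / (2 * x * y)"
        using 3 two by (simp add: eq_divide_eq)
      \<comment> \<open>Writing 2 as \<open>1 + 1\<close> exhibits it as an element of the
        field.\<close>
      also have "\<dots> = (c v ^ 2 - x ^ 2 - y ^ 2 * c w ^ 2) / ((1 + 1) * x * y)" by simp
      also have "\<dots> \<in> ?E"
        using E'(9)[OF xy(1), of 2] E'(9)[OF xy(2), of 2] xy(1,2) v2 w2 by (intro E'(2,4,5,6,8))
      finally show ?thesis using w by simp
    qed
  qed
qed

text \<open>Splitting the subsets by whether they contain \<open>v\<close> gives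
  \<open>A x + c v * A ?x = 0\<close> with both values of \<open>A\<close> in the field generated by
  the other roots. As \<open>c v\<close> is outside that field, both vanish, and the induction
  hypothesis applies to each.\<close>

lemma sqrt_products_independent:
  fixes c :: "'i \<Rightarrow> 'l::field"
  assumes two: "(2::'l) \<noteq> 0" and K: "is_subfield K"
    and "finite F"
    and "\<And>u. u \<in> F \<Longrightarrow> c u ^ 2 \<in> K"
    and "\<And>S. S \<subseteq> F \<Longrightarrow> S \<noteq> {} \<Longrightarrow> prod c S \<notin> K"
    and "\<And>T. x T \<in> K"
    and "(\<Sum>T\<in>Pow F. x T * prod c T) = 0" and "T \<subseteq> F"
  shows "x T = 0"
  using assms(3-)
proof (induction F arbitrary: x T rule: finite_induct)
  case empty
  then show ?case by simp
next
  case (insert v F)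
  let ?E = "is_subfield hull (K \<union> c ` F)"
  have E: "is_subfield ?E" by (rule is_subfield_hull)
  note E' = is_subfieldD[OF E]
  have KE: "K \<union> c ` F \<subseteq> ?E" by (rule hull_subset)
  define A where "A y = (\<Sum>T\<in>Pow F. y T * prod c T)" for y
  have AE: "A y \<in> ?E" if "\<And>T. y T \<in> K" for y
    unfolding A_def using KE that
    by (intro is_subfield_sum[OF E] E'(6) is_subfield_prod[OF E]) blast+
  let ?x = "\<lambda>T. x (insert v T)"
  have "(\<Sum>T\<in>insert v ` Pow F. x T * prod c T) = (\<Sum>T\<in>Pow F. x (insert v T) * prod c (insert v T))"
    using insert.hyps by (intro sum.reindex_cong[OF _ refl]) (auto simp: inj_on_def)
  also have "\<dots> = c v * A ?x"
    unfolding A_def sum_distrib_left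
  proof (intro sum.cong refl)
    fix T assume "T \<in> Pow F"
    then have "finite T" "v \<notin> T" using insert.hyps finite_subset by auto
    then show "x (insert v T) * prod c (insert v T) = c v * (x (insert v T) * prod c T)" by simp
  qed
  finally have "(\<Sum>T\<in>Pow (insert v F). x T * prod c T) = A x + c v * A ?x"
    using insert.hyps unfolding Pow_insert A_def
    by (subst sum.union_disjoint) auto
  then have sum0: "A x + c v * A ?x = 0" using insert.prems(4) by simp
  have "c v \<notin> ?E"
    using insert.hyps by (intro sqrt_notin_multiquadratic[OF two K] insert.prems) auto
  moreover have "c v * A ?x = - A x"
    using sum0 by (simp add: eq_neg_iff_add_eq_0 add.commute)
  then have "c v = - A x / A ?x" if "A ?x \<noteq> 0"
    using that by (simp only: eq_divide_eq not_False_eq_True if_True)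
  ultimately have "A ?x = 0" using AE[of x] AE[of ?x] insert.prems(3) E' by metis
  with sum0 have "A x = 0" by simp
  have IH: "y T = 0" if "\<And>T. y T \<in> K" "A y = 0" "T \<subseteq> F" for y T
  proof (rule insert.IH[of y T])
    show "(\<Sum>T\<in>Pow F. y T * prod c T) = 0" using that(2) unfolding A_def .
    show "c u ^ 2 \<in> K" if "u \<in> F" for u using insert.prems(1) that by blast
    show "prod c S \<notin> K" if "S \<subseteq> F" "S \<noteq> {}" for S using insert.prems(2) that by blast
  qed (rule that(1), rule that(3))
  show ?case
  proof (cases "v \<in> T")
    case True
    then have "T - {v} \<subseteq> F" "insert v (T - {v}) = T" using insert.prems(5) by auto
    with IH[of ?x "T - {v}"] \<open>A ?x = 0\<close> insert.prems(3) show ?thesis by simp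
  next
    case False
    then show ?thesis using IH[of x T] \<open>A x = 0\<close> insert.prems(3,5) by auto
  qed
qed

section \<open>A criterion for the quotient to be a domain\<close>

text \<open>Matches finite sets of variables with squarefree monomials, to reach the sum over
  \<open>Pow F\<close> in \<open>sqrt_products_independent\<close>.\<close>

definition mono_indicator :: "'i set \<Rightarrow> 'i \<Rightarrow>\<^sub>0 nat" where
  "mono_indicator T = (\<Sum>v\<in>T. Poly_Mapping.single v 1)"

lemma lookup_mono_indicator:
  "finite T \<Longrightarrow> Poly_Mapping.lookup (mono_indicator T) v = (if v \<in> T then 1 else 0)"
  by (simp add: mono_indicator_def lookup_sum lookup_single when_def)

lemma keys_mono_indicator: "finite T \<Longrightarrow> Poly_Mapping.keys (mono_indicator T) = T"
  by (auto simp: in_keys_iff lookup_mono_indicator split: if_splits)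

lemma mono_eval_indicator: "finite T \<Longrightarrow> mono_eval c (mono_indicator T) = prod c T"
  by (simp add: mono_eval_def keys_mono_indicator lookup_mono_indicator)

text \<open>Evaluating each variable at its square root is unaffected by reduction, and independence
  makes it injective on reduced polynomials. Its kernel is therefore that of
  \<open>normal_form\<close>.\<close>

lemma domain_square_root_ring:
  fixes a :: "'i \<Rightarrow> 'r::comm_ring_1" and \<eta> :: "'r \<Rightarrow> 'l::field" and c :: "'i \<Rightarrow> 'l"
  assumes \<eta>: "additive \<eta>" "\<And>x y. \<eta> (x * y) = \<eta> x * \<eta> y" "\<eta> 1 = 1" "\<And>x. \<eta> x = 0 \<Longrightarrow> x = 0"
    and K: "is_subfield K" "\<And>x. \<eta> x \<in> K" and two: "(2::'l) \<noteq> 0"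
    and c: "\<And>v. c v ^ 2 = \<eta> (a v)"
    and nonsquare: "\<And>S. finite S \<Longrightarrow> S \<subseteq> I \<Longrightarrow> S \<noteq> {} \<Longrightarrow> prod c S \<notin> K"
  shows "domain (square_root_ring a I)"
proof -
  let ?\<phi> = "monoid_algebra_eval \<eta> (mono_eval c)"
  have \<phi>_nf: "?\<phi> (normal_form a p) = ?\<phi> p" for p
  proof (rule additive_eq_on_singles[where F="\<lambda>p. ?\<phi> (normal_form a p)" and G="?\<phi>"])
    show "additive (\<lambda>p. ?\<phi> (normal_form a p))"
      by (simp add: additive_def additive.add[OF additive_normal_form] additive.add[OF additive_eval[OF \<eta>(1)]])
    show "additive ?\<phi>" by (rule additive_eval[OF \<eta>(1)])
    fix m :: "'i \<Rightarrow>\<^sub>0 nat" and b :: 'r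
    have pow: "\<eta> (x ^ k) = \<eta> x ^ k" for x k by (induction k) (simp_all add: \<eta>)
    have prod: "\<eta> (prod f A) = prod (\<lambda>v. \<eta> (f v)) A" for f and A :: "'i set"
      by (induction A rule: infinite_finite_induct) (simp_all add: \<eta>)
    have "\<eta> (mono_eval a h) = mono_eval c (h + h)" for h
      unfolding mono_eval_add by (simp add: mono_eval_def prod pow prod.distrib[symmetric]
          power_mult_distrib power2_eq_square flip: c)
    then have "mono_eval c m = \<eta> (mono_eval a (mono_half m)) * mono_eval c (mono_parity m)"
      using mono_eval_add[of c "mono_parity m" "mono_half m + mono_half m"]
      by (simp add: mono_parity_half mult.commute)
    then show "?\<phi> (normal_form a (Poly_Mapping.single m b)) = ?\<phi> (Poly_Mapping.single m b)"
      by (simp add: normal_form_single eval_single[OF \<eta>(1)] \<eta>(2) mult_ac)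
  qed
  have inj: "q = 0" if q: "q \<in> reduced_in I" "?\<phi> q = 0" for q
  proof -
    define F where "F = (\<Union>m\<in>Poly_Mapping.keys q. Poly_Mapping.keys m)"
    have F: "finite F" "F \<subseteq> I" using q(1) by (auto simp: F_def reduced_in_def)
    have finT: "finite T" if "T \<in> Pow F" for T using F(1) that finite_subset by auto
    have ind: "m = mono_indicator (Poly_Mapping.keys m)" if "m \<in> Poly_Mapping.keys q" for m
    proof (rule poly_mapping_eqI)
      fix v
      have "Poly_Mapping.lookup m v \<le> 1" using q(1) that by (auto simp: reduced_in_def)
      then show "Poly_Mapping.lookup m v
          = Poly_Mapping.lookup (mono_indicator (Poly_Mapping.keys m)) v"
        by (simp add: lookup_mono_indicator in_keys_iff)
    qed
    have sub: "Poly_Mapping.keys q \<subseteq> mono_indicator ` Pow F"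
      using ind by (fastforce simp: F_def)
    have "additive (\<lambda>b. \<eta> b * mono_eval c m)" for m
      by (simp add: additive_def additive.add[OF \<eta>(1)] distrib_right)
    then have "?\<phi> q = (\<Sum>m\<in>mono_indicator ` Pow F. \<eta> (Poly_Mapping.lookup q m) * mono_eval c m)"
      unfolding monoid_algebra_eval_def using F(1) sub by (intro lin_ext_superset) auto
    also have "\<dots> = (\<Sum>T\<in>Pow F. \<eta> (Poly_Mapping.lookup q (mono_indicator T)) * prod c T)"
    proof (intro sum.reindex_cong[OF _ refl])
      show "inj_on mono_indicator (Pow F)"
        using keys_mono_indicator[OF finT] by (intro inj_on_inverseI)
    qed (simp add: mono_eval_indicator finT)
    finally have sum0: "(\<Sum>T\<in>Pow F. \<eta> (Poly_Mapping.lookup q (mono_indicator T)) * prod c T) = 0"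
      using q(2) by simp
    have "\<eta> (Poly_Mapping.lookup q (mono_indicator T)) = 0" if "T \<subseteq> F" for T
    proof (rule sqrt_products_independent[OF two K(1) F(1) _ _ _ sum0 that])
      show "c u ^ 2 \<in> K" for u using K(2) c by simp
      show "prod c S \<notin> K" if "S \<subseteq> F" "S \<noteq> {}" for S
        using nonsquare finT[of S] F(2) that by blast
    qed (rule K(2))
    then have "Poly_Mapping.lookup q m = 0" if "m \<in> Poly_Mapping.keys q" for m
      using sub that \<eta>(4) by blast
    then show "q = 0" by (metis in_keys_iff keys_eq_empty all_not_in_conv)
  qed
  show ?thesis
  proof (rule square_root_quotient.domain_if_eval)
    show "?\<phi> (p * q) = ?\<phi> p * ?\<phi> q" for p q
      by (rule eval_mult[OF \<eta>(1,2) mono_eval_add])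
    show "?\<phi> 1 \<noteq> 0"
      using eval_single[OF \<eta>(1), of "mono_eval c" 0 1] \<eta>(3) by simp
    show "?\<phi> p = 0 \<longleftrightarrow> normal_form a p = 0" if "p \<in> polys_in I" for p
      using inj[OF normal_form_in_reduced_in[OF that]] \<phi>_nf[of p]
        additive.zero[OF additive_eval[OF \<eta>(1)]] by metis
  qed
qed

section \<open>Odd powers of linear polynomials\<close>

text \<open>An action of the integers has \<open>\<tau> (- 1)\<close> as inverse of
  \<open>\<tau> 1\<close>. This serves translations, dilations and the orbits of roots.\<close>

lemma int_iterate_flow:
  assumes zero: "\<And>x. \<tau> 0 x = x" and add: "\<And>j k x. \<tau> (j + k) x = \<tau> j (\<tau> k x)"
  shows "int_iterate (\<tau> 1) j = \<tau> j"
proof -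
  have inv: "inv_into UNIV (\<tau> 1) = \<tau> (- 1)"
    using add[of 1 "- 1"] add[of "- 1" 1] zero by (intro inv_equality) simp_all
  have pow: "(\<tau> i ^^ k) x = \<tau> (int k * i) x" for i k x
  proof (induction k)
    case 0
    then show ?case by (simp add: zero)
  next
    case (Suc k)
    then show ?case using add[of i "int k * i" x] by (simp add: algebra_simps)
  qed
  show ?thesis
    by (rule ext) (simp add: int_iterate_def inv pow)
qed

section \<open>Polynomials inside the algebraic closure of the rational functions\<close>

definition poly_embed :: "'k::field poly \<Rightarrow> 'k poly fract alg_closure" where
  "poly_embed p = to_ac (Fract p 1)"

lemma poly_embed_simps [simp]:
  "poly_embed 0 = 0" "poly_embed 1 = 1" "poly_embed (p + q) = poly_embed p + poly_embed q"
  "poly_embed (p - q) = poly_embed p - poly_embed q"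
  "poly_embed (p * q) = poly_embed p * poly_embed q" "poly_embed (p ^ n) = poly_embed p ^ n"
proof -
  show [simp]: "poly_embed 1 = 1"
    by (simp add: poly_embed_def flip: One_fract_def)
  show [simp]: "poly_embed (p * q) = poly_embed p * poly_embed q" for p q
    by (simp add: poly_embed_def flip: to_ac_mult)
  show "poly_embed (p ^ n) = poly_embed p ^ n" by (induction n) simp_all
qed (simp_all add: poly_embed_def flip: Zero_fract_def to_ac_add to_ac_diff)

lemma poly_embed_prod: "poly_embed (prod f A) = (\<Prod>x\<in>A. poly_embed (f x))"
  by (induction A rule: infinite_finite_induct) simp_all

lemma poly_embed_eq_iff: "poly_embed p = poly_embed q \<longleftrightarrow> p = q"
  by (simp add: poly_embed_def eq_fract)

lemma additive_poly_embed: "additive poly_embed"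
  by (simp add: additive_def)

lemma range_poly_embed: "range poly_embed \<subseteq> range to_ac"
  by (auto simp: poly_embed_def)

lemma is_subfield_range_to_ac: "is_subfield (range to_ac)"
  unfolding is_subfield_def
  by (auto simp flip: to_ac_1 to_ac_diff to_ac_mult to_ac_inverse)

lemma order_prod:
  fixes f :: "'i \<Rightarrow> 'a::idom poly"
  assumes "finite A" "\<And>x. x \<in> A \<Longrightarrow> f x \<noteq> 0"
  shows "Polynomial.order l (prod f A) = (\<Sum>x\<in>A. Polynomial.order l (f x))"
  using assms by (induction A rule: finite_induct) (simp_all add: order_mult order_0I)

lemma order_power_eq:
  fixes p :: "'a::idom poly"
  assumes "p \<noteq> 0"
  shows "Polynomial.order l (p ^ n) = n * Polynomial.order l p"
  using assms by (induction n) (simp_all add: order_mult order_0I)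

text \<open>The leading coefficient is kept general because dilation makes a linear factor
  non-monic.\<close>

lemma order_linear_poly:
  fixes b d :: "'a::field"
  assumes "d \<noteq> 0"
  shows "Polynomial.order l [:b, d:] = (if l = - b / d then 1 else 0)"
proof -
  have "[:b, d:] = smult d [:b / d, 1:]" using assms by simp
  then have "Polynomial.order l [:b, d:] = Polynomial.order l [:b / d, 1:]"
    using order_smult[OF assms] by metis
  also have "\<dots> = (if l = - b / d then 1 else 0)"
    using order_power_n_n[of "- (b / d)" 1] by (auto intro!: order_0I simp: add_eq_0_iff)
  finally show ?thesis .
qed

text \<open>If the product of roots is \<open>p / q\<close>, then the square of \<open>p\<close> is
  the product of the linear powers times the square of \<open>q\<close>. At the root of one factor
  no other factor vanishes, so the order there is even on one side and odd on the other.\<close>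

lemma odd_linear_powers_not_square:
  fixes b d :: "'i \<Rightarrow> 'k::field" and c :: "'i \<Rightarrow> 'k poly fract alg_closure"
  assumes d: "\<And>v. v \<in> I \<Longrightarrow> d v \<noteq> 0" and inj: "inj_on (\<lambda>v. - b v / d v) I"
    and odd: "\<And>v. v \<in> I \<Longrightarrow> odd (n v)"
    and c: "\<And>v. v \<in> I \<Longrightarrow> c v ^ 2 = poly_embed ([:b v, d v:] ^ n v)"
    and S: "finite S" "S \<subseteq> I" "S \<noteq> {}"
  shows "prod c S \<notin> range to_ac"
proof
  let ?q = "\<lambda>v. [:b v, d v:]"
  assume "prod c S \<in> range to_ac"
  then obtain p q where pq: "q \<noteq> 0" "prod c S = to_ac (Fract p q)"
    by (metis Fract_cases rangeE)
  have "poly_embed p = to_ac (Fract p q) * poly_embed q"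
    using pq(1) by (simp add: poly_embed_def eq_fract flip: to_ac_mult)
  then have "poly_embed (p ^ 2) = prod c S ^ 2 * poly_embed (q ^ 2)"
    by (simp add: pq(2) power_mult_distrib)
  also have "prod c S ^ 2 = poly_embed (\<Prod>v\<in>S. ?q v ^ n v)"
    unfolding prod_power_distrib poly_embed_prod using S(2) c by (intro prod.cong) auto
  finally have eq: "p ^ 2 = (\<Prod>v\<in>S. ?q v ^ n v) * q ^ 2"
    by (simp add: poly_embed_eq_iff flip: poly_embed_simps)
  obtain u where u: "u \<in> S" using S(3) by blast
  have q0: "?q v ^ n v \<noteq> 0" if "v \<in> S" for v using d[of v] S(2) that by auto
  then have prod0: "(\<Prod>v\<in>S. ?q v ^ n v) \<noteq> 0" using S(1) by simp
  then have "p \<noteq> 0" using eq pq(1) by auto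
  define l where "l = - b u / d u"
  have "Polynomial.order l (\<Prod>v\<in>S. ?q v ^ n v) = (\<Sum>v\<in>S. Polynomial.order l (?q v ^ n v))"
    using S(1) q0 by (intro order_prod) auto
  also have "\<dots> = (\<Sum>v\<in>S. if v = u then n u else 0)"
  proof (intro sum.cong refl)
    fix v assume v: "v \<in> S"
    have "l = - b v / d v \<longleftrightarrow> v = u"
      using inj_onD[OF inj, of u v] u v S(2) by (auto simp: l_def)
    then show "Polynomial.order l (?q v ^ n v) = (if v = u then n u else 0)"
      using d[of v] v S(2) by (subst order_power_eq) (auto simp: order_linear_poly)
  qed
  also have "\<dots> = n u" using S(1) u by simp
  finally have "2 * Polynomial.order l p = n u + 2 * Polynomial.order l q"
    using arg_cong[OF eq, of "Polynomial.order l"] \<open>p \<noteq> 0\<close> pq(1) prod0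
    by (simp add: order_mult order_power_eq)
  moreover have "odd (n u)" using odd u S(2) by blast
  ultimately show False by presburger
qed

text \<open>The form shared by both cases: \<eta> embeds either base ring in the same field, where
  each radicand is an odd power of a linear polynomial with a root of its own.\<close>

lemma domain_odd_linear_powers:
  fixes a :: "'i \<Rightarrow> 'r::comm_ring_1" and \<eta> :: "'r \<Rightarrow> 'k::field_char_0 poly fract alg_closure"
  assumes \<eta>: "additive \<eta>" "\<And>x y. \<eta> (x * y) = \<eta> x * \<eta> y" "\<eta> 1 = 1" "\<And>x. \<eta> x = 0 \<Longrightarrow> x = 0"
      "range \<eta> \<subseteq> range to_ac"
    and a: "\<And>v. v \<in> I \<Longrightarrow> \<eta> (a v) = poly_embed ([:b v, d v:] ^ n v)"
    and d: "\<And>v. v \<in> I \<Longrightarrow> d v \<noteq> 0" and inj: "inj_on (\<lambda>v. - b v / d v) I"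
    and odd: "\<And>v. v \<in> I \<Longrightarrow> odd (n v)"
  shows "domain (square_root_ring a I)"
proof -
  have "\<forall>v. \<exists>y. y ^ 2 = \<eta> (a v)" by (simp add: nth_root_exists)
  then obtain c where c: "\<And>v. c v ^ 2 = \<eta> (a v)" by metis
  \<comment> \<open>That 2 is nonzero in the closure is inherited from the constants, by injectivity
    of the embedding.\<close>
  have "poly_embed [:2 :: 'k:] \<noteq> poly_embed 0" unfolding poly_embed_eq_iff by simp
  moreover have "poly_embed [:2 :: 'k:] = poly_embed (1 + 1)"
    by (simp only: poly_embed_eq_iff) (simp add: one_pCons)
  ultimately have "(1 + 1 :: 'k poly fract alg_closure) \<noteq> 0"
    by (metis poly_embed_simps(1-3))
  then have two: "(2 :: 'k poly fract alg_closure) \<noteq> 0" by simp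
  show ?thesis
  proof (rule domain_square_root_ring[OF \<eta>(1-4) is_subfield_range_to_ac _ two c])
    show "\<eta> x \<in> range to_ac" for x using \<eta>(5) by blast
    show "prod c S \<notin> range to_ac" if "finite S" "S \<subseteq> I" "S \<noteq> {}" for S
      using that c a by (intro odd_linear_powers_not_square[OF d inj odd]) auto
  qed
qed

section \<open>The ring B and the iterates of the automorphisms\<close>

lemma B_ring_eq_square_root_ring:
  "B_ring \<sigma> h r = square_root_ring (\<lambda>(i, j). int_iterate \<sigma> (- j) (h i)) ({1..r} \<times> UNIV)"
proof -
  have "B_relations \<sigma> h r
      = square_relations (\<lambda>(i, j). int_iterate \<sigma> (- j) (h i)) ({1..r} \<times> UNIV)"
    by (auto simp: B_relations_def square_relations_def image_def)
  then show ?thesis by (simp add: B_ring_def square_root_ring_def Let_def)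
qed

lemma coherent_B_ring: "noetherian TYPE('r::comm_ring_1) \<Longrightarrow> coherent_ring (B_ring \<sigma> (h :: nat \<Rightarrow> 'r) r)"
  unfolding B_ring_eq_square_root_ring by (rule square_root_quotient.coherent)

lemma int_iterate_poly_translate:
  "int_iterate (poly_translate :: 'k::comm_ring_1 poly \<Rightarrow> _) j p = p \<circ>\<^sub>p [:of_int j, 1:]"
proof -
  have "int_iterate ((\<lambda>j p. p \<circ>\<^sub>p [:of_int j, 1:]) 1) j = (\<lambda>p :: 'k poly. p \<circ>\<^sub>p [:of_int j, 1:])"
    by (rule int_iterate_flow) (simp_all add: pcompose_idR pcompose_pCons add_ac flip: pcompose_assoc)
  moreover have "(\<lambda>j p. p \<circ>\<^sub>p [:of_int j, 1:]) 1 = (poly_translate :: 'k poly \<Rightarrow> _)"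
    by (simp add: poly_translate_def fun_eq_iff)
  ultimately show ?thesis by (simp only:)
qed

lemma lookup_laurent_dilate:
  "Poly_Mapping.lookup (laurent_dilate \<xi> p) k = \<xi> powi k * Poly_Mapping.lookup p k"
  by (simp add: laurent_dilate_def lookup_mapp when_def in_keys_iff)

lemma int_iterate_laurent_dilate:
  fixes \<xi> :: "'k::field"
  assumes "\<xi> \<noteq> 0"
  shows "int_iterate (laurent_dilate \<xi>) j = laurent_dilate (\<xi> powi j)"
proof -
  have "int_iterate ((\<lambda>j. laurent_dilate (\<xi> powi j)) 1) j = (\<lambda>j. laurent_dilate (\<xi> powi j)) j"
    using assms
    by (intro int_iterate_flow)
      (auto intro!: poly_mapping_eqI simp: lookup_laurent_dilate power_int_add power_int_mult_distrib mult_ac)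
  then show ?thesis by simp
qed

section \<open>Laurent polynomials\<close>

text \<open>The inclusion of k[z], as evaluation at \<open>laurent_X\<close>, so that induction
  along \<open>pCons\<close> applies.\<close>

definition laurent_of_poly :: "'k::field poly \<Rightarrow> 'k laurent_poly" where
  "laurent_of_poly p = poly (map_poly laurent_const p) laurent_X"

lemma laurent_const_simps [simp]:
  "laurent_const 0 = 0" "laurent_const 1 = 1"
  "laurent_const (a + b) = laurent_const a + laurent_const b"
  "laurent_const (a * b :: 'k::field) = laurent_const a * laurent_const b"
  by (simp_all add: laurent_const_def single_add mult_single)

lemma laurent_of_poly_0 [simp]: "laurent_of_poly 0 = 0"
  by (simp add: laurent_of_poly_def)

lemma laurent_of_poly_pCons:
  "laurent_of_poly (pCons a p) = laurent_const a + laurent_X * laurent_of_poly p"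
  by (simp add: laurent_of_poly_def map_poly_pCons)

lemma laurent_of_poly_add: "laurent_of_poly (p + q) = laurent_of_poly p + laurent_of_poly q"
  by (induction p q rule: poly_induct2) (simp_all add: laurent_of_poly_pCons algebra_simps)

lemma laurent_of_poly_smult: "laurent_of_poly (smult a p) = laurent_const a * laurent_of_poly p"
  by (induction p) (simp_all add: laurent_of_poly_pCons algebra_simps)

lemma laurent_of_poly_mult: "laurent_of_poly (p * q) = laurent_of_poly p * laurent_of_poly q"
  by (induction p)
    (simp_all add: laurent_of_poly_pCons laurent_of_poly_add laurent_of_poly_smult algebra_simps)

lemma laurent_of_poly_monom: "laurent_of_poly (monom a n) = Poly_Mapping.single (int n) a"
proof (induction n)
  case 0
  then show ?case by (simp add: monom_0 laurent_of_poly_pCons laurent_const_def)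
next
  case (Suc n)
  then show ?case
    by (simp add: monom_Suc laurent_of_poly_pCons laurent_X_def mult_single)
qed

lemma laurent_clear_denominators:
  "\<exists>N p. Poly_Mapping.single (int N) 1 * x = laurent_of_poly p"
proof (induction x rule: poly_mapping_single_add_induct)
  case zero
  have "Poly_Mapping.single (int 0) 1 * 0 = laurent_of_poly 0" by simp
  then show ?case by blast
next
  case (single k c)
  \<comment> \<open>Any shift by at least \<open>- k\<close> would do; \<open>\<bar>k\<bar>\<close>
    works for either sign.\<close>
  define N where "N = nat \<bar>k\<bar>"
  have "int (nat (int N + k)) = int N + k" unfolding N_def by auto
  then have "Poly_Mapping.single (int N) 1 * Poly_Mapping.single k c
      = laurent_of_poly (monom c (nat (int N + k)))"
    by (simp add: laurent_of_poly_monom mult_single)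
  then show ?case by blast
next
  case (add x y)
  then obtain M N p q where MN: "Poly_Mapping.single (int M) 1 * x = laurent_of_poly p"
    "Poly_Mapping.single (int N) 1 * y = laurent_of_poly q" by blast
  have *: "Poly_Mapping.single (int (M + N)) (1 :: 'a)
      = Poly_Mapping.single (int M) 1 * Poly_Mapping.single (int N) 1"
    by (simp add: mult_single)
  have "Poly_Mapping.single (int (M + N)) 1 * (x + y)
      = Poly_Mapping.single (int N) 1 * (Poly_Mapping.single (int M) 1 * x)
        + Poly_Mapping.single (int M) 1 * (Poly_Mapping.single (int N) 1 * y)"
    unfolding * by (simp only: distrib_left distrib_right mult_ac)
  also have "\<dots> = laurent_of_poly (monom 1 N * p + monom 1 M * q)"
    unfolding MN by (simp add: laurent_of_poly_add laurent_of_poly_mult laurent_of_poly_monom)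
  finally show ?case by blast
qed

lemma laurent_monomial_unit:
  "Poly_Mapping.single (- int N) 1 * (Poly_Mapping.single (int N) 1 * x) = (x :: 'k::field laurent_poly)"
  by (simp add: mult_single flip: mult.assoc)

text \<open>Localisation at z: an ideal is generated by its contraction to k[z], since a power of z
  clears denominators and is a unit.\<close>

lemma noetherian_laurent: "noetherian TYPE('k::field laurent_poly)"
  unfolding noetherian_def
proof (intro allI impI)
  fix I :: "'k laurent_poly set" assume I: "Modules.module.subspace (*) I"
  interpret L: Modules.module "(*) :: 'k laurent_poly \<Rightarrow> _" by (rule module_times)
  interpret P: Modules.module "(*) :: 'k poly \<Rightarrow> _" by (rule module_times)
  have "P.subspace {p. laurent_of_poly p \<in> I}"
    using L.subspace_0[OF I] L.subspace_add[OF I] L.subspace_scale[OF I]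
    by (intro P.subspaceI) (auto simp: laurent_of_poly_add laurent_of_poly_mult)
  then obtain g where g: "{p. laurent_of_poly p \<in> I} = P.span {g}"
    using euclidean_ideal_principal by blast
  have "I = L.span {laurent_of_poly g}"
  proof
    have "laurent_of_poly g \<in> I" using g P.span_base[of g "{g}"] by blast
    then show "L.span {laurent_of_poly g} \<subseteq> I" by (intro L.span_minimal I) simp
    show "I \<subseteq> L.span {laurent_of_poly g}"
    proof
      fix x assume x: "x \<in> I"
      obtain N p where Np: "Poly_Mapping.single (int N) 1 * x = laurent_of_poly p"
        using laurent_clear_denominators by blast
      then have "laurent_of_poly p \<in> I" using L.subspace_scale[OF I x] by metis
      then have "p \<in> P.span {g}" using g by blast
      then obtain q where "p = q * g" by (auto simp: P.span_singleton)
      then have "x = Poly_Mapping.single (- int N) 1 * (laurent_of_poly q * laurent_of_poly g)"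
        using laurent_monomial_unit[of N x] Np by (simp add: laurent_of_poly_mult)
      then have "x = (Poly_Mapping.single (- int N) 1 * laurent_of_poly q) * laurent_of_poly g"
        by (simp only: mult.assoc)
      then show "x \<in> L.span {laurent_of_poly g}" by (auto simp: L.span_singleton)
    qed
  qed
  then show "\<exists>S. finite S \<and> I = L.span S" by (intro exI[of _ "{laurent_of_poly g}"]) simp
qed

section \<open>Laurent polynomials inside the same field\<close>

definition laurent_embed :: "'k::field laurent_poly \<Rightarrow> 'k poly fract alg_closure" where
  "laurent_embed = monoid_algebra_eval (\<lambda>c. poly_embed [:c:]) (\<lambda>k. poly_embed [:0, 1:] powi k)"

lemma poly_embed_const:
  fixes a b :: "'k::field"
  shows "additive (\<lambda>c :: 'k. poly_embed [:c:])"
    and "poly_embed [:a * b:] = poly_embed [:a:] * poly_embed [:b:]"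
proof -
  show "additive (\<lambda>c :: 'k. poly_embed [:c:])"
  proof
    fix x y :: 'k
    show "poly_embed [:x + y:] = poly_embed [:x:] + poly_embed [:y:]"
      using poly_embed_simps(3)[of "[:x:]" "[:y:]"] by simp
  qed
  show "poly_embed [:a * b:] = poly_embed [:a:] * poly_embed [:b:]"
    using poly_embed_simps(5)[of "[:a:]" "[:b:]"] by (simp add: mult.commute)
qed

lemma poly_embed_X_nonzero: "poly_embed [:0, 1 :: 'k::field:] \<noteq> 0"
  using poly_embed_eq_iff[of "[:0, 1 :: 'k:]" 0] by simp

lemma additive_laurent_embed: "additive laurent_embed"
  unfolding laurent_embed_def by (rule additive_eval[OF poly_embed_const(1)])

lemma laurent_embed_mult: "laurent_embed (x * y) = laurent_embed x * laurent_embed y"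
  unfolding laurent_embed_def
  by (rule eval_mult[OF poly_embed_const]) (simp add: power_int_add poly_embed_X_nonzero)

lemma laurent_embed_single:
  "laurent_embed (Poly_Mapping.single k c) = poly_embed [:c:] * poly_embed [:0, 1:] powi k"
  unfolding laurent_embed_def by (rule eval_single[OF poly_embed_const(1)])

lemma laurent_embed_of_poly: "laurent_embed (laurent_of_poly p) = poly_embed p"
proof (induction p)
  case 0
  then show ?case by (simp add: additive.zero[OF additive_laurent_embed])
next
  case (pCons a p)
  have "pCons a p = [:a:] + [:0, 1:] * p" by simp
  then have "poly_embed (pCons a p) = poly_embed [:a:] + poly_embed [:0, 1:] * poly_embed p"
    by (metis poly_embed_simps(3,5))
  with pCons show ?case
    using laurent_embed_single[of 0 a] laurent_embed_single[of 1 "1 :: 'a"]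
    by (simp add: laurent_of_poly_pCons additive.add[OF additive_laurent_embed] laurent_embed_mult
        laurent_const_def laurent_X_def flip: one_pCons)
qed

text \<open>Clearing denominators reduces this to injectivity of \<open>poly_embed\<close>; the
  power of z cancels as a unit.\<close>

lemma laurent_embed_eq_0:
  assumes "laurent_embed x = 0"
  shows "x = 0"
proof -
  obtain N p where Np: "Poly_Mapping.single (int N) 1 * x = laurent_of_poly p"
    using laurent_clear_denominators by blast
  then have "poly_embed p = poly_embed 0"
    using assms laurent_embed_mult laurent_embed_of_poly
    by (metis mult_zero_right poly_embed_simps(1))
  then have "p = 0" by (simp only: poly_embed_eq_iff)
  then show ?thesis
    using laurent_monomial_unit[of N x, unfolded Np] by (simp only: laurent_of_poly_0 mult_zero_right)
qed

lemma range_laurent_embed: "range laurent_embed \<subseteq> range to_ac"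
proof safe
  fix x :: "'k::field laurent_poly"
  note K = is_subfieldD[OF is_subfield_range_to_ac]
  have poly: "poly_embed p \<in> range to_ac" for p :: "'k poly" using range_poly_embed by blast
  have powi: "y powi k \<in> range to_ac" if "y \<in> range to_ac" for y :: "'k poly fract alg_closure" and k
    using K(9)[OF that, of "nat k"] K(9)[OF K(7)[OF that], of "nat (- k)"]
    by (simp add: power_int_def)
  show "laurent_embed x \<in> range to_ac"
  proof (induction x rule: poly_mapping_single_add_induct)
    case zero
    show ?case unfolding additive.zero[OF additive_laurent_embed] by (rule K(1))
  next
    case (single m c)
    show ?case unfolding laurent_embed_single by (intro K(6) poly powi)
  next
    case (add p q)
    then show ?case unfolding additive.add[OF additive_laurent_embed] by (intro K(4))
  qed
qed

text \<open>Dilating and then embedding is evaluation at d z instead of z. As an evaluation it is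
  multiplicative, which reduces the power to its base.\<close>

lemma laurent_embed_dilate:
  fixes \<alpha> d :: "'k::field"
  assumes d: "d \<noteq> 0"
  shows "laurent_embed (laurent_dilate d ((laurent_X - laurent_const \<alpha>) ^ n)) = poly_embed ([:- \<alpha>, d:] ^ n)"
proof -
  let ?e = "monoid_algebra_eval (\<lambda>c. poly_embed [:c:]) (\<lambda>k. (poly_embed [:d:] * poly_embed [:0, 1:]) powi k)"
  have d0: "poly_embed [:d:] \<noteq> 0" using poly_embed_eq_iff[of "[:d:]" 0] d by simp
  have add: "additive ?e" by (rule additive_eval[OF poly_embed_const(1)])
  note single = eval_single[OF poly_embed_const(1)]
  have mult: "?e (x * y) = ?e x * ?e y" for x y
    by (rule eval_mult[OF poly_embed_const]) (simp add: power_int_add poly_embed_X_nonzero d0)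
  have one: "?e 1 = 1" using single[of "(powi) (poly_embed [:d:] * poly_embed [:0, 1:])" 0 "1 :: 'k"]
    by (simp flip: one_pCons)
  have power: "?e (x ^ n) = ?e x ^ n" for x by (induction n) (simp_all add: one mult)
  have pow: "poly_embed [:c ^ n:] = poly_embed [:c:] ^ n" for c :: 'k and n
    by (simp only: poly_embed_simps(6)[symmetric] poly_const_pow)
  have inv: "poly_embed [:inverse c:] = inverse (poly_embed [:c:])" for c :: 'k
  proof (cases "c = 0")
    case False
    then have "poly_embed [:c:] * poly_embed [:inverse c:] = 1"
      using poly_embed_const(2)[of c "inverse c"] by (simp flip: one_pCons)
    then show ?thesis by (metis inverse_unique)
  qed simp
  have powi: "poly_embed [:d powi k:] = poly_embed [:d:] powi k" for k
    by (simp add: power_int_def pow inv)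
  have "laurent_embed (laurent_dilate d x) = ?e x" for x
  proof (rule additive_eq_on_singles[where F="\<lambda>x. laurent_embed (laurent_dilate d x)"])
    have "laurent_dilate d (x + y) = laurent_dilate d x + laurent_dilate d y" for x y
      by (rule poly_mapping_eqI) (simp add: lookup_laurent_dilate lookup_add distrib_left)
    then show "additive (\<lambda>x. laurent_embed (laurent_dilate d x))"
      by (simp add: additive_def additive.add[OF additive_laurent_embed])
    fix k c
    have "laurent_dilate d (Poly_Mapping.single k c) = Poly_Mapping.single k (d powi k * c)"
      by (rule poly_mapping_eqI) (simp add: lookup_laurent_dilate lookup_single when_def)
    then show "laurent_embed (laurent_dilate d (Poly_Mapping.single k c)) = ?e (Poly_Mapping.single k c)"
      by (simp add: laurent_embed_single single poly_embed_const(2) powi power_int_mult_distrib mult_ac)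
  qed (rule add)
  then have "laurent_embed (laurent_dilate d ((laurent_X - laurent_const \<alpha>) ^ n))
      = ?e (laurent_X - laurent_const \<alpha>) ^ n"
    by (simp only: power)
  also have "?e (laurent_X - laurent_const \<alpha>) = poly_embed [:d:] * poly_embed [:0, 1:] - poly_embed [:\<alpha>:]"
    unfolding laurent_X_def laurent_const_def additive.diff[OF add] single by (simp flip: one_pCons)
  also have "\<dots> = poly_embed [:- \<alpha>, d:]"
    by (simp flip: poly_embed_simps)
  finally show ?thesis by simp
qed

section \<open>The two cases\<close>

text \<open>If two shifted roots coincide, the roots lie on one orbit and are equal, so
  \<open>i = i'\<close>; the difference of the shifts then fixes a root and is zero by
  \<open>free\<close>.\<close>

lemma inj_on_root_orbits:
  fixes \<alpha> :: "nat \<Rightarrow> 'k" and \<tau> :: "int \<Rightarrow> 'k \<Rightarrow> 'k"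
  assumes inj: "inj_on \<alpha> A" and roots: "\<alpha> ` A \<subseteq> Z"
    and zero: "\<And>x. \<tau> 0 x = x" and add: "\<And>j k x. \<tau> (j + k) x = \<tau> j (\<tau> k x)"
    and orbit: "\<And>x y. x \<in> Z \<Longrightarrow> y \<in> Z \<Longrightarrow> x \<noteq> y \<Longrightarrow> \<not> same_orbit (\<tau> 1) x y"
    and free: "\<And>x j. x \<in> Z \<Longrightarrow> \<tau> j x = x \<Longrightarrow> j = 0"
  shows "inj_on (\<lambda>(i, j). \<tau> (- j) (\<alpha> i)) (A \<times> UNIV)"
proof (rule inj_onI, clarify)
  fix i j i' j'
  assume i: "i \<in> A" "i' \<in> A" and eq: "\<tau> (- j) (\<alpha> i) = \<tau> (- j') (\<alpha> i')"
  have eq': "\<alpha> i' = \<tau> (j' - j) (\<alpha> i)"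
    using arg_cong[OF eq, of "\<tau> j'"] add[of j' "- j'" "\<alpha> i'"] add[of j' "- j" "\<alpha> i"] zero by simp
  have Z: "\<alpha> i \<in> Z" "\<alpha> i' \<in> Z" using i roots by auto
  have "same_orbit (\<tau> 1) (\<alpha> i) (\<alpha> i')"
    unfolding same_orbit_def int_iterate_flow[of \<tau>, OF zero add] using eq' by blast
  with orbit Z have "\<alpha> i = \<alpha> i'" by blast
  then have "i = i'" using inj_onD[OF inj] i by blast
  moreover have "j' - j = 0"
    using free[OF Z(1)] eq' \<open>\<alpha> i = \<alpha> i'\<close> by metis
  ultimately show "i = i' \<and> j = j'" by simp
qed

lemma power_pcompose: "(p ^ m) \<circ>\<^sub>p q = (p \<circ>\<^sub>p q) ^ m" for p :: "'a::comm_ring_1 poly"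
  by (induction m) (simp_all add: pcompose_mult pcompose_1)

theorem proposition5p12:
  fixes f :: "'k::{alg_closed_field, field_char_0} poly"
    and r :: nat
    and \<alpha> :: "nat \<Rightarrow> 'k"
    and n :: "nat \<Rightarrow> nat"
  assumes monic: "lead_coeff f = 1"
    and roots: "bij_betw \<alpha> {1..r} {x. poly f x = 0}"
    and multiplicities: "\<forall>i\<in>{1..r}. n i = Polynomial.order (\<alpha> i) f"
  shows
    "((\<forall>a b. poly f a = 0 \<and> poly f b = 0 \<and> a \<noteq> b \<longrightarrow> \<not> same_orbit (\<lambda>x. x - 1) a b) \<longrightarrow>
        (let B = B_ring poly_translate (\<lambda>i. [:- \<alpha> i, 1:] ^ n i) r in
           ((\<forall>i\<in>{1..r}. odd (n i)) \<longrightarrow> domain B) \<and> coherent_ring B))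
     \<and>
     (\<forall>\<xi>::'k. \<xi> \<noteq> 0 \<longrightarrow> (\<forall>m>0. \<xi> ^ m \<noteq> 1) \<longrightarrow> poly f 0 \<noteq> 0 \<longrightarrow>
        (\<forall>a b. poly f a = 0 \<and> poly f b = 0 \<and> a \<noteq> b \<longrightarrow> \<not> same_orbit (\<lambda>x. inverse \<xi> * x) a b) \<longrightarrow>
        (let B = B_ring (laurent_dilate \<xi>) (\<lambda>i. (laurent_X - laurent_const (\<alpha> i)) ^ n i) r in
           ((\<forall>i\<in>{1..r}. odd (n i)) \<longrightarrow> domain B) \<and> coherent_ring B))"
proof (intro conjI impI allI)
  let ?Z = "{x. poly f x = 0}"
  have \<alpha>: "inj_on \<alpha> {1..r}" "\<alpha> ` {1..r} \<subseteq> ?Z"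
    using roots by (auto simp: bij_betw_def)
  {
    assume orbits: "\<forall>a b. poly f a = 0 \<and> poly f b = 0 \<and> a \<noteq> b \<longrightarrow> \<not> same_orbit (\<lambda>x. x - 1) a b"
    let ?B = "B_ring poly_translate (\<lambda>i. [:- \<alpha> i, 1:] ^ n i) r"
    \<comment> \<open>The radicand with indices \<open>i\<close>, \<open>j\<close> is a power of z -
      j - \<open>\<alpha> i\<close>, whose root is \<open>\<alpha> i + of_int j\<close>. Freeness of
      the translations is characteristic zero.\<close>
    have "inj_on (\<lambda>(i, j). \<alpha> i - of_int (- j)) ({1..r} \<times> UNIV)"
      using inj_on_root_orbits[OF \<alpha>, of "\<lambda>j x. x - of_int j"] orbits by simp
    \<comment> \<open>The same roots in the shape \<open>- b v / d v\<close>, with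
      \<open>d v = 1\<close>.\<close>
    then have inj: "inj_on (\<lambda>v. - (case v of (i, j) \<Rightarrow> - \<alpha> i - of_int j) / 1) ({1..r} \<times> UNIV)"
      by (simp add: case_prod_unfold add.commute)
    have "domain ?B" if "\<forall>i\<in>{1..r}. odd (n i)"
      unfolding B_ring_eq_square_root_ring
    proof (rule domain_odd_linear_powers[OF additive_poly_embed poly_embed_simps(5,2) _
          range_poly_embed _ _ inj])
      fix v :: "nat \<times> int"
      obtain i j where v: "v = (i, j)" by (cases v)
      show "poly_embed (case v of (i, j) \<Rightarrow> int_iterate poly_translate (- j) ([:- \<alpha> i, 1:] ^ n i))
          = poly_embed ([:case v of (i, j) \<Rightarrow> - \<alpha> i - of_int j, 1:] ^ (n (fst v)))"
        by (simp add: v int_iterate_poly_translate power_pcompose pcompose_pCons)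
      show "odd (n (fst v))" if "v \<in> {1..r} \<times> UNIV" using that \<open>\<forall>i\<in>{1..r}. odd (n i)\<close> by auto
    next
      fix p :: "'k poly"
      show "poly_embed p = 0 \<Longrightarrow> p = 0" using poly_embed_eq_iff[of p 0] by simp
    qed simp
    moreover have "coherent_ring ?B" by (rule coherent_B_ring[OF noetherian_euclidean])
    ultimately show "let B = ?B in ((\<forall>i\<in>{1..r}. odd (n i)) \<longrightarrow> domain B) \<and> coherent_ring B"
      by (simp add: Let_def)
  }
  fix \<xi> :: 'k
  assume \<xi>: "\<xi> \<noteq> 0" "\<forall>m>0. \<xi> ^ m \<noteq> 1" and f0: "poly f 0 \<noteq> 0"
    and orbits: "\<forall>a b. poly f a = 0 \<and> poly f b = 0 \<and> a \<noteq> b \<longrightarrow>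
      \<not> same_orbit (\<lambda>x. inverse \<xi> * x) a b"
  let ?B = "B_ring (laurent_dilate \<xi>) (\<lambda>i. (laurent_X - laurent_const (\<alpha> i)) ^ n i) r"
  have powi_ne: "j = 0" if "inverse \<xi> powi j = 1" for j
  proof (rule ccontr)
    assume "j \<noteq> 0"
    \<comment> \<open>Passing to the absolute value turns any nonzero exponent into a positive one,
      to which the hypothesis on \<xi> applies.\<close>
    have "\<xi> ^ nat \<bar>j\<bar> = 1"
      using that \<xi>(1) by (auto simp: power_int_def power_inverse split: if_splits)
    with \<open>j \<noteq> 0\<close> \<xi>(2) show False by simp
  qed
  have "inj_on (\<lambda>(i, j). inverse \<xi> powi (- j) * \<alpha> i) ({1..r} \<times> UNIV)"
  proof (rule inj_on_root_orbits[OF \<alpha>, of "\<lambda>j x. inverse \<xi> powi j * x"])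
    \<comment> \<open>Roots are nonzero because \<open>poly f 0 \<noteq> 0\<close>, so a dilation
      that fixes one has factor 1.\<close>
    show "j = 0" if "x \<in> ?Z" "inverse \<xi> powi j * x = x" for x j
      using that f0 by (intro powi_ne) auto
  qed (use \<xi>(1) orbits in \<open>auto simp: power_int_add mult.assoc\<close>)
  \<comment> \<open>The dilated factor has constant term \<open>- \<alpha> i\<close> and leading
    coefficient \<open>\<xi> powi (- j)\<close>, hence its root is
    \<open>\<xi> powi j * \<alpha> i\<close>.\<close>
  then have inj: "inj_on (\<lambda>v. - (- \<alpha> (fst v)) / \<xi> powi (- snd v)) ({1..r} \<times> UNIV)"
    using \<xi>(1) by (simp add: case_prod_unfold power_int_minus power_int_inverse field_simps)
  have "domain ?B" if "\<forall>i\<in>{1..r}. odd (n i)"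
    unfolding B_ring_eq_square_root_ring
  proof (rule domain_odd_linear_powers[OF additive_laurent_embed laurent_embed_mult _
        laurent_embed_eq_0 range_laurent_embed _ _ inj])
    show "laurent_embed (1 :: 'k laurent_poly) = 1"
      using laurent_embed_single[of 0 "1 :: 'k"] by (simp flip: one_pCons)
    fix v :: "nat \<times> int"
    obtain i j where v: "v = (i, j)" by (cases v)
    show "laurent_embed (case v of (i, j) \<Rightarrow>
          int_iterate (laurent_dilate \<xi>) (- j) ((laurent_X - laurent_const (\<alpha> i)) ^ n i))
        = poly_embed ([:- \<alpha> (fst v), \<xi> powi (- snd v):] ^ (n (fst v)))"
      using \<xi>(1) by (simp add: v int_iterate_laurent_dilate laurent_embed_dilate del: poly_embed_simps)
    show "odd (n (fst v))" if "v \<in> {1..r} \<times> UNIV" using that \<open>\<forall>i\<in>{1..r}. odd (n i)\<close> by auto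
  qed (use \<xi>(1) in auto)
  moreover have "coherent_ring ?B" by (rule coherent_B_ring[OF noetherian_laurent])
  ultimately show "let B = ?B in ((\<forall>i\<in>{1..r}. odd (n i)) \<longrightarrow> domain B) \<and> coherent_ring B"
    by (simp add: Let_def)
qed

end
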